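(* Let $L$ be a domain, let $E$ be a quasisober topological space with Borel $\sigma$-algebra $\mathcal{B}$, and let $\nu : \mathcal{B} \to L$ be an $L$-valued maxitive measure. Then $\nu$ has a cardinal density if and only if $\nu$ is completely maxitive. Also, consider the following assertions: (1) $\nu$ is regular; (2) $\nu$ has a usc cardinal density; (3) $\nu$ is outer-continuous and completely maxitive; (4) $\nu$ is weakly outer-continuous and weakly inner-continuous; (5) $\nu$ is weakly outer-continuous and $\sigma$-maxitive; (6) $\nu$ is weakly outer-continuous; (7) $\nu$ is $\mathcal{Q}$-smooth and saturated; (8) $\nu$ is $\mathcal{Q}$-smooth, weakly inner-continuous, and saturated; (9) $\nu$ is $\mathcal{Q}$-smooth, $\sigma$-maxitive, and saturated. Then (1) $\Leftrightarrow$ (2) $\Leftrightarrow$ (3) $\Leftrightarrow$ (4) $\Rightarrow$ (5) $\Rightarrow$ (6) $\Rightarrow$ (7) $\Leftarrow$ (8). Moreover: (i) if $E$ is second-countable, then (1) $\Leftrightarrow$ (2) $\Leftrightarrow$ (3) $\Leftrightarrow$ (4) $\Leftrightarrow$ (5); (ii) if $E$ is locally compact, then (8) $\Leftrightarrow$ (1) $\Leftrightarrow$ (2) $\Leftrightarrow$ (3) $\Leftrightarrow$ (4), and (6) $\Leftrightarrow$ (7); (iii) if $E$ is $\sigma$-compact and metrizable, then (9) $\Leftrightarrow$ (1) $\Leftrightarrow$ (2) $\Leftrightarrow$ (3) $\Leftrightarrow$ (4) $\Leftrightarrow$ (5); (iv) if $E$ is locally compact Polish, then (8) $\Leftrightarrow$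 (9) $\Leftrightarrow$ (1) $\Leftrightarrow$ (2) $\Leftrightarrow$ (3) $\Leftrightarrow$ (4) $\Leftrightarrow$ (5), and (6) $\Leftrightarrow$ (7).
   Context: Order theory. $\bigoplus$ and $\oplus$ denote suprema, $\bigwedge$ infima; an equation involving them asserts that the supremum/infimum exists and has the stated value. A subset $F$ of a poset $L$ is filtered if it is nonempty and any $r,s\in F$ have a lower bound $t\in F$; a filter is a filtered upper set. In $L$, $s \gg r$ ($s$ is way-above $r$) means: for every filter $F$ having an infimum, $r \geqslant \bigwedge F$ implies $s \in F$. $L$ is continuous if for all $r \in L$ the set $\{s \in L: s \gg r\}$ is a filter with infimum $r$. $L$ is filtered-complete if every filter has an infimum. A domain is a filtered-complete continuous poset; every domain is assumed to have a bottom element $0$. Topology. $\mathcal{G}$ and $\mathcal{F}$ are the collections of open and closed subsets of $E$. A subset is irreducible if it is nonempty and whenever it is contained in the union of two closed sets it is contained in one of them; $E$ is quasisober if every irreducible closed subset is the closure of a singleton. $A \subset E$ is saturated if it is an intersection of open subsets; $\uparrow\! A$ (the saturation of $A$) is the intersection of all open subsets containing $A$. Compact does not require Hausdorff. $\mathcal{Q}$ is the collection of compact saturated subsets. $\mathcal{B}$ is the $\sigma$-algebra generated by $\mathcal{G}$ and $\mathcal{Q}$. $\mathcal{K}$ is the collection of compact subsets belonging to $\mathcal{B}$. Locally compact means that every point has a neighbourhood base of compact sets. Maxitive measures. A map $\nu : \mathcal{B} \to L$ is a maxitive measure (resp. $\sigma$-maxitive, completely maxitive) if $\nu(\emptyset)=0$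 and for every finite (resp. countable, arbitrary) family $(B_j)_{j\in J}$ in $\mathcal{B}$ with $\bigcup_j B_j \in \mathcal{B}$, the supremum of $\{\nu(B_j): j\in J\}$ exists and equals $\nu(\bigcup_j B_j)$. Put $\nu^{+}(B) = \bigwedge_{G \in \mathcal{G}, G \supset B} \nu(G)$ for $B\in\mathcal{B}$. $\nu$ is: - inner-continuous if $\nu(B) = \bigoplus_{K \in \mathcal{K}, K \subset B} \nu(\uparrow\! K)$ for all $B \in \mathcal{B}$; - outer-continuous if $\nu(B)=\nu^{+}(B)$ for all $B \in \mathcal{B}$; - regular if it is inner-continuous and outer-continuous; - weakly inner-continuous if $\nu(G) = \bigoplus_{K \in \mathcal{K}, K \subset G} \nu^{+}(K)$ for all $G \in \mathcal{G}$; - weakly outer-continuous if $\nu(K) = \nu^{+}(K)$ for all $K \in \mathcal{K}$; - saturated if $\nu(K) = \nu(\uparrow\! K)$ for all $K \in \mathcal{K}$; - $\mathcal{Q}$-smooth if $\bigwedge_{j} \nu(Q_j) = \nu(\bigcap_j Q_j)$ for every filtered family $(Q_j)_{j \in J}$ (nonempty, directed downwards by inclusion) in $\mathcal{Q}$ (in a quasisober space $\mathcal{Q}$ is closed under filtered intersections). A cardinal density of $\nu$ is a map $c : E \to L$ with $\nu(B) = \bigoplus_{x\in B} c(x)$ for all $B \in \mathcal{B}$. A map $c:E\to L$ is usc (upper-semicontinuous) if $\{x\in E : t \gg c(x)\}$ is open for all $t\in L$. *)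

theory Defs
  imports "HOL-Analysis.Analysis" "HOL-Library.Lub_Glb"
begin

section \<open>Domains\<close>

text \<open>
  Suprema and infima in a poset are treated relationally: \<open>isLub UNIV A x\<close> (\<open>isGlb UNIV A x\<close>)
  says that the supremum (infimum) of \<open>A\<close> exists and is \<open>x\<close>.
\<close>

definition filtered :: "'a::order set \<Rightarrow> bool" where
  "filtered F \<longleftrightarrow> F \<noteq> {} \<and> (\<forall>r\<in>F. \<forall>s\<in>F. \<exists>t\<in>F. t \<le> r \<and> t \<le> s)"

definition poset_filter :: "'a::order set \<Rightarrow> bool" where
  "poset_filter F \<longleftrightarrow> filtered F \<and> (\<forall>r\<in>F. \<forall>s. r \<le> s \<longrightarrow> s \<in> F)"

definition way_above :: "'a::order \<Rightarrow> 'a \<Rightarrow> bool" (infix \<open>\<ggreater>\<close> 50) where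
  "s \<ggreater> r \<longleftrightarrow> (\<forall>F x. poset_filter F \<and> isGlb UNIV F x \<and> x \<le> r \<longrightarrow> s \<in> F)"

definition filtered_complete :: "'l::order itself \<Rightarrow> bool" where
  "filtered_complete _ \<longleftrightarrow> (\<forall>F::'l set. poset_filter F \<longrightarrow> (\<exists>x. isGlb UNIV F x))"

definition continuous_poset :: "'l::order itself \<Rightarrow> bool" where
  "continuous_poset _ \<longleftrightarrow> (\<forall>r::'l. poset_filter {s. s \<ggreater> r} \<and> isGlb UNIV {s. s \<ggreater> r} r)"

text \<open>The bottom element comes from the sort \<^class>\<open>order_bot\<close>.\<close>

definition poset_domain :: "'l::order_bot itself \<Rightarrow> bool" where
  "poset_domain L \<longleftrightarrow> filtered_complete L \<and> continuous_poset L"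

section \<open>Topology\<close>

definition irreducible_in :: "'e topology \<Rightarrow> 'e set \<Rightarrow> bool" where
  "irreducible_in X A \<longleftrightarrow> A \<subseteq> topspace X \<and> A \<noteq> {} \<and>
     (\<forall>C D. closedin X C \<and> closedin X D \<and> A \<subseteq> C \<union> D \<longrightarrow> A \<subseteq> C \<or> A \<subseteq> D)"

definition quasisober :: "'e topology \<Rightarrow> bool" where
  "quasisober X \<longleftrightarrow>
     (\<forall>C. closedin X C \<and> irreducible_in X C \<longrightarrow> (\<exists>x\<in>topspace X. C = X closure_of {x}))"

text \<open>The intersection with \<open>topspace X\<close> takes care of the empty family of open sets.\<close>

definition saturated_in :: "'e topology \<Rightarrow> 'e set \<Rightarrow> bool" where
  "saturated_in X A \<longleftrightarrow> (\<exists>\<U>. (\<forall>U\<in>\<U>. openin X U) \<and> A = topspace X \<inter> \<Inter>\<U>)"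

definition saturation :: "'e topology \<Rightarrow> 'e set \<Rightarrow> 'e set" where
  "saturation X A = \<Inter>{G. openin X G \<and> A \<subseteq> G}"

definition compact_saturated :: "'e topology \<Rightarrow> 'e set set" where
  "compact_saturated X = {Q. compactin X Q \<and> saturated_in X Q}"

definition borel_sets :: "'e topology \<Rightarrow> 'e set set" where
  "borel_sets X = sigma_sets (topspace X) ({G. openin X G} \<union> compact_saturated X)"

definition compact_borel :: "'e topology \<Rightarrow> 'e set set" where
  "compact_borel X = {K \<in> borel_sets X. compactin X K}"

text \<open>
  Strong form of local compactness (a neighbourhood base of compact sets at each point), which in
  the non-Hausdorff setting differs from \<^const>\<open>locally_compact_space\<close>.
\<close>

definition locally_compact_nbhds :: "'e topology \<Rightarrow> bool" where
  "locally_compact_nbhds X \<longleftrightarrow> neighbourhood_base_of (compactin X) X"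

definition sigma_compact :: "'e topology \<Rightarrow> bool" where
  "sigma_compact X \<longleftrightarrow>
     (\<exists>\<C>. countable \<C> \<and> (\<forall>C\<in>\<C>. compactin X C) \<and> \<Union>\<C> = topspace X)"

definition polish :: "'e topology \<Rightarrow> bool" where
  "polish X \<longleftrightarrow> separable_space X \<and> completely_metrizable_space X"

section \<open>Maxitive measures\<close>

text \<open>
  A maxitive measure is a total function of which only the values on \<open>borel_sets X\<close> matter.
  Families of Borel sets are given by their ranges, since unions and suprema depend only on those.
\<close>

definition maxitive :: "'e topology \<Rightarrow> ('e set \<Rightarrow> 'l::order_bot) \<Rightarrow> bool" where
  "maxitive X \<nu> \<longleftrightarrow> \<nu> {} = bot \<and>
     (\<forall>\<A>. \<A> \<subseteq> borel_sets X \<and> finite \<A> \<and> \<Union>\<A> \<in> borel_sets X \<longrightarrow> isLub UNIV (\<nu> ` \<A>) (\<nu> (\<Union>\<A>)))"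

definition sigma_maxitive :: "'e topology \<Rightarrow> ('e set \<Rightarrow> 'l::order_bot) \<Rightarrow> bool" where
  "sigma_maxitive X \<nu> \<longleftrightarrow> \<nu> {} = bot \<and>
     (\<forall>\<A>. \<A> \<subseteq> borel_sets X \<and> countable \<A> \<and> \<Union>\<A> \<in> borel_sets X \<longrightarrow> isLub UNIV (\<nu> ` \<A>) (\<nu> (\<Union>\<A>)))"

definition completely_maxitive :: "'e topology \<Rightarrow> ('e set \<Rightarrow> 'l::order_bot) \<Rightarrow> bool" where
  "completely_maxitive X \<nu> \<longleftrightarrow> \<nu> {} = bot \<and>
     (\<forall>\<A>. \<A> \<subseteq> borel_sets X \<and> \<Union>\<A> \<in> borel_sets X \<longrightarrow> isLub UNIV (\<nu> ` \<A>) (\<nu> (\<Union>\<A>)))"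

text \<open>
  The infimum defining \<open>\<nu>\<^sup>+\<close> exists whenever \<open>\<nu>\<close> is a maxitive measure with values in a domain;
  see \<open>outer_ext_isGlb\<close> below.
\<close>

definition outer_ext :: "'e topology \<Rightarrow> ('e set \<Rightarrow> 'l::order_bot) \<Rightarrow> 'e set \<Rightarrow> 'l" where
  "outer_ext X \<nu> B = (THE x. isGlb UNIV (\<nu> ` {G. openin X G \<and> B \<subseteq> G}) x)"

definition inner_continuous :: "'e topology \<Rightarrow> ('e set \<Rightarrow> 'l::order_bot) \<Rightarrow> bool" where
  "inner_continuous X \<nu> \<longleftrightarrow>
     (\<forall>B\<in>borel_sets X. isLub UNIV ((\<lambda>K. \<nu> (saturation X K)) ` {K \<in> compact_borel X. K \<subseteq> B}) (\<nu> B))"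

definition outer_continuous :: "'e topology \<Rightarrow> ('e set \<Rightarrow> 'l::order_bot) \<Rightarrow> bool" where
  "outer_continuous X \<nu> \<longleftrightarrow> (\<forall>B\<in>borel_sets X. \<nu> B = outer_ext X \<nu> B)"

definition regular_maxitive :: "'e topology \<Rightarrow> ('e set \<Rightarrow> 'l::order_bot) \<Rightarrow> bool" where
  "regular_maxitive X \<nu> \<longleftrightarrow> inner_continuous X \<nu> \<and> outer_continuous X \<nu>"

definition weakly_inner_continuous :: "'e topology \<Rightarrow> ('e set \<Rightarrow> 'l::order_bot) \<Rightarrow> bool" where
  "weakly_inner_continuous X \<nu> \<longleftrightarrow>
     (\<forall>G. openin X G \<longrightarrow> isLub UNIV (outer_ext X \<nu> ` {K \<in> compact_borel X. K \<subseteq> G}) (\<nu> G))"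

definition weakly_outer_continuous :: "'e topology \<Rightarrow> ('e set \<Rightarrow> 'l::order_bot) \<Rightarrow> bool" where
  "weakly_outer_continuous X \<nu> \<longleftrightarrow> (\<forall>K\<in>compact_borel X. \<nu> K = outer_ext X \<nu> K)"

definition saturated_measure :: "'e topology \<Rightarrow> ('e set \<Rightarrow> 'l::order_bot) \<Rightarrow> bool" where
  "saturated_measure X \<nu> \<longleftrightarrow> (\<forall>K\<in>compact_borel X. \<nu> K = \<nu> (saturation X K))"

definition Q_smooth :: "'e topology \<Rightarrow> ('e set \<Rightarrow> 'l::order_bot) \<Rightarrow> bool" where
  "Q_smooth X \<nu> \<longleftrightarrow>
     (\<forall>\<D>. \<D> \<subseteq> compact_saturated X \<and> filtered \<D> \<longrightarrow> isGlb UNIV (\<nu> ` \<D>) (\<nu> (\<Inter>\<D>)))"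

definition cardinal_density ::
    "'e topology \<Rightarrow> ('e set \<Rightarrow> 'l::order_bot) \<Rightarrow> ('e \<Rightarrow> 'l) \<Rightarrow> bool" where
  "cardinal_density X \<nu> c \<longleftrightarrow> (\<forall>B\<in>borel_sets X. isLub UNIV (c ` B) (\<nu> B))"

definition usc :: "'e topology \<Rightarrow> ('e \<Rightarrow> 'l::order) \<Rightarrow> bool" where
  "usc X c \<longleftrightarrow> (\<forall>t. openin X {x \<in> topspace X. t \<ggreater> c x})"

lemma outer_ext_isGlb:
  fixes \<nu> :: "'e set \<Rightarrow> 'l::order_bot"
  assumes dom: "poset_domain TYPE('l)" and max: "maxitive X \<nu>" and sub: "B \<subseteq> topspace X"
  shows "isGlb UNIV (\<nu> ` {G. openin X G \<and> B \<subseteq> G}) (outer_ext X \<nu> B)"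
proof -
  define A where "A = \<nu> ` {G. openin X G \<and> B \<subseteq> G}"
  define F where "F = {s. \<exists>a\<in>A. a \<le> s}"
  have borel: "G \<in> borel_sets X" if "openin X G" for G
    using that by (simp add: borel_sets_def sigma_sets.Basic)
  have mono: "\<nu> G \<le> \<nu> H" if "openin X G" "openin X H" "G \<subseteq> H" for G H
  proof -
    have "{G, H} \<subseteq> borel_sets X" "\<Union>{G, H} \<in> borel_sets X"
      using that borel by (auto intro: openin_Un)
    then have "isLub UNIV (\<nu> ` {G, H}) (\<nu> (\<Union>{G, H}))"
      using max unfolding maxitive_def by blast
    moreover have "\<Union>{G, H} = H"
      using that by auto
    ultimately have "isLub UNIV (\<nu> ` {G, H}) (\<nu> H)"
      by simp
    then show ?thesis
      by (rule isLubD2) simp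
  qed
  have "topspace X \<in> {G. openin X G \<and> B \<subseteq> G}"
    using sub by simp
  then have "A \<noteq> {}"
    unfolding A_def by blast
  have lower: "\<exists>t\<in>A. t \<le> a \<and> t \<le> b" if "a \<in> A" "b \<in> A" for a b
  proof -
    obtain G H where "openin X G" "B \<subseteq> G" "a = \<nu> G" "openin X H" "B \<subseteq> H" "b = \<nu> H"
      using \<open>a \<in> A\<close> \<open>b \<in> A\<close> unfolding A_def by auto
    then have "\<nu> (G \<inter> H) \<in> A" "\<nu> (G \<inter> H) \<le> a" "\<nu> (G \<inter> H) \<le> b"
      unfolding A_def by (auto intro!: mono openin_Int)
    then show ?thesis by blast
  qed
  have "\<exists>t\<in>F. t \<le> r \<and> t \<le> s" if "r \<in> F" "s \<in> F" for r s
  proof -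
    obtain a b where ab: "a \<in> A" "a \<le> r" "b \<in> A" "b \<le> s"
      using \<open>r \<in> F\<close> \<open>s \<in> F\<close> unfolding F_def by blast
    then obtain t where "t \<in> A" "t \<le> a" "t \<le> b"
      using lower by blast
    then have "t \<in> F" "t \<le> r" "t \<le> s"
      using ab unfolding F_def by (blast intro: order_trans)+
    then show ?thesis by blast
  qed
  moreover have "F \<noteq> {}"
    using \<open>A \<noteq> {}\<close> unfolding F_def by blast
  moreover have "s \<in> F" if "r \<in> F" "r \<le> s" for r s
    using that unfolding F_def by (blast intro: order_trans)
  ultimately have "poset_filter F"
    unfolding poset_filter_def filtered_def by blast
  then obtain x where "isGlb UNIV F x"
    using dom unfolding poset_domain_def filtered_complete_def by blast
  moreover have "isLb UNIV F y \<longleftrightarrow> isLb UNIV A y" for y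
    unfolding isLb_def setge_def F_def by (auto intro: order_trans)
  ultimately have x: "isGlb UNIV A x"
    by (simp add: isGlb_def greatestP_def setle_def)
  have "y = x" if "isGlb UNIV A y" for y
    using x that by (auto simp: isGlb_def greatestP_def setle_def intro: order_antisym)
  with x show ?thesis
    unfolding outer_ext_def A_def by (rule theI)
qed

end

theory Submission
  imports Defs
begin

text \<open>
  The outer extension of \<open>\<nu>\<close> at singletons, \<open>c x = \<nu>\<^sup>+ {x}\<close>, is always usc, and compactness gives
  \<open>\<nu>\<^sup>+ K = sup c K\<close> for every compact \<open>K\<close>. The sets \<open>cl {x} \<inter> \<up>x\<close> are compact Borel sets and
  are the atoms of the Borel \<open>\<sigma>\<close>-algebra; hence weak outer-continuity already forces \<open>c x \<le> \<nu> B\<close>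
  for \<open>x \<in> B\<close>, and the remaining conditions only serve to prove that \<open>\<nu> B\<close> is below every upper
  bound \<open>u\<close> of \<open>c\<close> on \<open>B\<close>. For this it suffices to bound \<open>\<nu> B\<close> by each \<open>s \<ggreater> u\<close>, by covering \<open>B\<close>
  with open sets whose measure is at most \<open>s\<close>. Smoothness along filtered families of compact
  saturated sets comes from the fact that quasisober spaces are well-filtered.
\<close>

section \<open>Continuous posets\<close>

lemma isLub_UNIV_iff:
  "isLub UNIV A x \<longleftrightarrow> (\<forall>a\<in>A. a \<le> x) \<and> (\<forall>u. (\<forall>a\<in>A. a \<le> u) \<longrightarrow> x \<le> u)"
  by (auto simp: isLub_def leastP_def isUb_def setle_def setge_def)

lemma isGlb_UNIV_iff:
  "isGlb UNIV A x \<longleftrightarrow> (\<forall>a\<in>A. x \<le> a) \<and> (\<forall>l. (\<forall>a\<in>A. l \<le> a) \<longrightarrow> l \<le> x)"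
  by (auto simp: isGlb_def greatestP_def isLb_def setle_def setge_def)

text \<open>The principal filter of \<open>r\<close> has infimum \<open>r\<close>, so every element
  way above \<open>r\<close> belongs to it.\<close>

lemma way_above_imp_ge:
  assumes "s \<ggreater> r" shows "r \<le> s"
proof -
  have "poset_filter {x. r \<le> x}" "isGlb UNIV {x. r \<le> x} r"
    by (auto simp: poset_filter_def filtered_def isGlb_UNIV_iff)
  then show ?thesis
    using assms unfolding way_above_def by blast
qed

lemma way_above_ge_trans: "s \<ggreater> r \<Longrightarrow> r' \<le> r \<Longrightarrow> s \<ggreater> r'"
  unfolding way_above_def by (meson order_trans)

lemma ge_way_above_trans: "s \<le> s' \<Longrightarrow> s \<ggreater> r \<Longrightarrow> s' \<ggreater> r"
  unfolding way_above_def poset_filter_def by meson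

text \<open>The upward closure of a filtered set is a filter with the same infimum, so the relation
  can be tested on filtered sets of values of \<nu>.\<close>

lemma way_above_filtered:
  assumes "s \<ggreater> r" "filtered A" "isGlb UNIV A x" "x \<le> r"
  shows "\<exists>a\<in>A. a \<le> s"
proof -
  define F where "F = {s. \<exists>a\<in>A. a \<le> s}"
  have "poset_filter F"
    using assms(2) unfolding poset_filter_def filtered_def F_def by (blast intro: order_trans)
  moreover have "isGlb UNIV F x"
    using assms(3) unfolding isGlb_UNIV_iff F_def by (blast intro: order_trans)
  ultimately have "s \<in> F"
    using assms(1,4) unfolding way_above_def by blast
  then show ?thesis by (simp add: F_def)
qed

text \<open>The elements two way-above steps over \<open>r\<close> form a filter whose infimum is
  again \<open>r\<close>; by definition this filter contains \<open>s\<close>.\<close>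

lemma way_above_interpolation:
  fixes r :: "'l::order_bot"
  assumes dom: "poset_domain TYPE('l)" and "s \<ggreater> r"
  obtains t where "s \<ggreater> t" "t \<ggreater> r"
proof -
  have fil: "poset_filter {s. s \<ggreater> r}" and glb: "isGlb UNIV {s. s \<ggreater> r} r" for r :: 'l
    using dom unfolding poset_domain_def continuous_poset_def by blast+
  define F where "F = {s. \<exists>t. s \<ggreater> t \<and> t \<ggreater> r}"
  \<comment> \<open>A common \<open>t''\<close> below both intermediate points puts \<open>a\<close>
    and \<open>b\<close> into the single filter of elements way above \<open>t''\<close>.\<close>
  have "\<exists>c\<in>F. c \<le> a \<and> c \<le> b" if ab: "a \<in> F" "b \<in> F" for a b
  proof -
    obtain t t' where t: "a \<ggreater> t" "t \<ggreater> r" "b \<ggreater> t'" "t' \<ggreater> r"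
      using ab unfolding F_def by blast
    then obtain t'' where t'': "t'' \<ggreater> r" "t'' \<le> t" "t'' \<le> t'"
      using fil[of r] unfolding poset_filter_def filtered_def by blast
    then have "a \<ggreater> t''" "b \<ggreater> t''"
      using t way_above_ge_trans by blast+
    then obtain c where "c \<ggreater> t''" "c \<le> a" "c \<le> b"
      using fil[of t''] unfolding poset_filter_def filtered_def by blast
    then show ?thesis using t'' unfolding F_def by blast
  qed
  moreover have "F \<noteq> {}"
    using fil unfolding F_def poset_filter_def filtered_def by blast
  moreover have "b \<in> F" if "a \<in> F" "a \<le> b" for a b
    using that ge_way_above_trans unfolding F_def by blast
  ultimately have "poset_filter F"
    unfolding poset_filter_def filtered_def by blast
  moreover have "isGlb UNIV F r"
    unfolding isGlb_UNIV_iff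
  proof (intro conjI ballI allI impI)
    fix a assume "a \<in> F"
    then show "r \<le> a"
      unfolding F_def using way_above_imp_ge by (blast intro: order_trans)
  next
    fix l assume l: "\<forall>a\<in>F. l \<le> a"
    \<comment> \<open>Such a \<open>t\<close> is the infimum of the elements way above it, and these
      all lie in \<open>F\<close>.\<close>
    have "l \<le> t" if "t \<ggreater> r" for t
      using glb[of t] l that unfolding isGlb_UNIV_iff F_def by blast
    then show "l \<le> r"
      using glb[of r] unfolding isGlb_UNIV_iff by blast
  qed
  ultimately have "s \<in> F"
    using \<open>s \<ggreater> r\<close> unfolding way_above_def by blast
  then show thesis
    using that unfolding F_def by blast
qed

lemma le_if_le_way_above:
  fixes u :: "'l::order_bot"
  assumes "poset_domain TYPE('l)" "\<And>s. s \<ggreater> u \<Longrightarrow> x \<le> s"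
  shows "x \<le> u"
  using assms unfolding poset_domain_def continuous_poset_def isGlb_UNIV_iff by blast

text \<open>Testing against \<open>s\<close> way above an upper bound \<open>u\<close>, rather than
  against \<open>u\<close>, leaves the slack that covers by open sets of measure at most
  \<open>s\<close> require.\<close>

lemma isLub_if_le_way_above:
  fixes x :: "'l::order_bot"
  assumes "poset_domain TYPE('l)" "\<And>a. a \<in> A \<Longrightarrow> a \<le> x"
    and "\<And>u s. \<lbrakk>\<And>a. a \<in> A \<Longrightarrow> a \<le> u; s \<ggreater> u\<rbrakk> \<Longrightarrow> x \<le> s"
  shows "isLub UNIV A x"
  unfolding isLub_UNIV_iff
proof (intro conjI allI impI ballI)
  show "a \<le> x" if "a \<in> A" for a
    using that by (rule assms(2))
  show "x \<le> u" if "\<forall>a\<in>A. a \<le> u" for u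
  proof (rule le_if_le_way_above[OF assms(1)])
    show "x \<le> s" if "s \<ggreater> u" for s
      using \<open>\<forall>a\<in>A. a \<le> u\<close> that by (intro assms(3)[of u s]) simp_all
  qed
qed

section \<open>Saturations and compact saturated sets\<close>

lemma subset_saturation: "A \<subseteq> saturation X A"
  by (auto simp: saturation_def)

lemma saturation_least: "openin X G \<Longrightarrow> A \<subseteq> G \<Longrightarrow> saturation X A \<subseteq> G"
  by (auto simp: saturation_def)

lemma saturation_subset_iff: "openin X G \<Longrightarrow> saturation X A \<subseteq> G \<longleftrightarrow> A \<subseteq> G"
  using subset_saturation saturation_least by (metis order_trans)

lemma saturated_in_subset: "saturated_in X A \<Longrightarrow> A \<subseteq> topspace X"
  by (auto simp: saturated_in_def)

lemma saturated_in_openD: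
  "saturated_in X A \<Longrightarrow> x \<in> topspace X \<Longrightarrow> x \<notin> A \<Longrightarrow> \<exists>G. openin X G \<and> A \<subseteq> G \<and> x \<notin> G"
  by (auto simp: saturated_in_def)

text \<open>If \<open>A\<close> is not contained in the space, no open set contains it and
  \<open>saturation X A\<close> degenerates to \<open>UNIV\<close>; hence the hypothesis.\<close>

lemma saturated_in_saturation: "A \<subseteq> topspace X \<Longrightarrow> saturated_in X (saturation X A)"
  unfolding saturated_in_def
  by (rule exI[of _ "{G. openin X G \<and> A \<subseteq> G}"]) (auto simp: saturation_def)

text \<open>The open supersets of all members are pooled into one family.\<close>

lemma saturated_in_Inter:
  assumes "\<D> \<noteq> {}" "\<And>Q. Q \<in> \<D> \<Longrightarrow> saturated_in X Q"
  shows "saturated_in X (\<Inter>\<D>)"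
proof -
  have "\<Inter>\<D> = topspace X \<inter> \<Inter>{G. openin X G \<and> (\<exists>Q\<in>\<D>. Q \<subseteq> G)}" (is "_ = ?R")
  proof
    show "\<Inter>\<D> \<subseteq> ?R"
      using assms saturated_in_subset by fastforce
    show "?R \<subseteq> \<Inter>\<D>"
    proof
      fix x assume x: "x \<in> ?R"
      then have xX: "x \<in> topspace X" by (rule IntD1)
      have "x \<in> Q" if Q: "Q \<in> \<D>" for Q
      proof (rule ccontr)
        assume "x \<notin> Q"
        then obtain G where "openin X G" "Q \<subseteq> G" "x \<notin> G"
          using saturated_in_openD[OF assms(2)[OF Q] xX] by auto
        with Q have "G \<in> {G. openin X G \<and> (\<exists>Q\<in>\<D>. Q \<subseteq> G)}"
          by auto
        then show False
          using InterD[OF IntD2[OF x]] \<open>x \<notin> G\<close> by auto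
      qed
      then show "x \<in> \<Inter>\<D>" by blast
    qed
  qed
  then show ?thesis
    unfolding saturated_in_def by (intro exI[of _ "{G. openin X G \<and> (\<exists>Q\<in>\<D>. Q \<subseteq> G)}"]) simp
qed

text \<open>An open set contains \<open>A\<close> exactly when it contains the saturation, so the
  two sets have the same open covers.\<close>

lemma compactin_iff_saturation:
  assumes "A \<subseteq> topspace X"
  shows "compactin X (saturation X A) \<longleftrightarrow> compactin X A"
proof -
  have "saturation X A \<subseteq> topspace X"
    using assms saturation_least by blast
  moreover have "saturation X A \<subseteq> \<Union>\<U> \<longleftrightarrow> A \<subseteq> \<Union>\<U>" if "\<forall>U\<in>\<U>. openin X U" for \<U>
    using that by (simp add: saturation_subset_iff openin_Union)
  then have "((\<forall>U\<in>\<U>. openin X U) \<and> saturation X A \<subseteq> \<Union>\<U> \<longrightarrow>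
        (\<exists>\<F>. finite \<F> \<and> \<F> \<subseteq> \<U> \<and> saturation X A \<subseteq> \<Union>\<F>)) \<longleftrightarrow>
      ((\<forall>U\<in>\<U>. openin X U) \<and> A \<subseteq> \<Union>\<U> \<longrightarrow> (\<exists>\<F>. finite \<F> \<and> \<F> \<subseteq> \<U> \<and> A \<subseteq> \<Union>\<F>))" for \<U>
    by (cases "\<forall>U\<in>\<U>. openin X U") (simp_all add: subset_iff cong: conj_cong)
  ultimately show ?thesis
    using assms unfolding compactin_def by simp
qed

lemma saturation_compact_saturated:
  "compactin X K \<Longrightarrow> saturation X K \<in> compact_saturated X"
  by (simp add: compact_saturated_def compactin_iff_saturation saturated_in_saturation
      compactin_subset_topspace)

section \<open>Well-filteredness of quasisober spaces\<close>

text \<open>Zorn's lemma gives an open \<open>U\<close> containing \<open>G\<close> that is maximal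
  among those including no member of \<D>. Its complement is irreducible, hence the closure of a
  point, and this point is forced into every member of \<D>, so into \<open>U\<close>: a
  contradiction.\<close>

lemma quasisober_well_filtered:
  assumes qs: "quasisober X" and DQ: "\<D> \<subseteq> compact_saturated X" and fD: "filtered \<D>"
    and G: "openin X G" "\<Inter>\<D> \<subseteq> G"
  shows "\<exists>Q\<in>\<D>. Q \<subseteq> G"
proof (rule ccontr)
  assume no: "\<not> (\<exists>Q\<in>\<D>. Q \<subseteq> G)"
  define \<A> where "\<A> = {U. openin X U \<and> G \<subseteq> U \<and> (\<forall>Q\<in>\<D>. \<not> Q \<subseteq> U)}"
  have Qc: "compactin X Q" and Qs: "saturated_in X Q" if "Q \<in> \<D>" for Q
    using that DQ by (auto simp: compact_saturated_def)
  have "\<exists>M\<in>\<A>. \<forall>U\<in>\<A>. M \<subseteq> U \<longrightarrow> U = M"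
  proof (rule subset_Zorn_nonempty)
    show "\<A> \<noteq> {}"
      using no G unfolding \<A>_def by blast
    fix \<C> assume C: "\<C> \<noteq> {}" "subset.chain \<A> \<C>"
    then have CA: "\<C> \<subseteq> \<A>"
      by (simp add: subset.chain_def)
    \<comment> \<open>Finitely many members of the chain would cover the compact set
      \<open>Q\<close>, and the largest of them would contain \<open>Q\<close>. An empty subcover
      means that \<open>Q\<close> is empty.\<close>
    have "\<not> Q \<subseteq> \<Union>\<C>" if Q: "Q \<in> \<D>" for Q
    proof
      assume "Q \<subseteq> \<Union>\<C>"
      then obtain \<F> where F: "finite \<F>" "\<F> \<subseteq> \<C>" "Q \<subseteq> \<Union>\<F>"
        using Qc[OF Q] CA unfolding compactin_def \<A>_def by (metis (no_types, lifting) mem_Collect_eq subsetD)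
      obtain U where "U \<in> \<C>" "Q \<subseteq> U"
      proof (cases "\<F> = {}")
        case True
        then show ?thesis using F C that by blast
      next
        case False
        moreover have "subset.chain \<F> \<F>"
          using F(2) C(2) unfolding subset.chain_def by blast
        ultimately have "\<Union>\<F> \<in> \<F>"
          using F(1) Union_in_chain by blast
        then show ?thesis using F that by blast
      qed
      then show False using CA Q unfolding \<A>_def by blast
    qed
    moreover have "openin X (\<Union>\<C>)"
      using CA by (intro openin_Union) (auto simp: \<A>_def)
    moreover have "G \<subseteq> \<Union>\<C>"
      using C(1) CA unfolding \<A>_def by blast
    ultimately show "\<Union>\<C> \<in> \<A>"
      unfolding \<A>_def by blast
  qed
  then obtain U where UA: "U \<in> \<A>" and maxU: "\<And>V. V \<in> \<A> \<Longrightarrow> U \<subseteq> V \<Longrightarrow> V = U"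
    by blast
  then have U: "openin X U" "G \<subseteq> U" and noU: "\<And>Q. Q \<in> \<D> \<Longrightarrow> \<not> Q \<subseteq> U"
    by (simp_all add: \<A>_def)
  define C where "C = topspace X - U"
  have clC: "closedin X C"
    unfolding C_def using U(1) by (rule closedin_diff[OF closedin_topspace])
  \<comment> \<open>Adding the complement of \<open>D\<close> enlarges \<open>U\<close> strictly, so
    by maximality the larger open set contains a member of \<D>.\<close>
  have big: "\<exists>Q\<in>\<D>. Q \<subseteq> U \<union> (topspace X - D)" if "closedin X D" "\<not> C \<subseteq> D" for D
  proof -
    have "openin X (U \<union> (topspace X - D))"
      using that(1) U(1) by (intro openin_Un openin_diff) simp_all
    moreover have "U \<union> (topspace X - D) \<noteq> U"
      using that(2) unfolding C_def by blast
    ultimately show ?thesis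
      using maxU[of "U \<union> (topspace X - D)"] U(2) unfolding \<A>_def by blast
  qed
  have "irreducible_in X C"
    unfolding irreducible_in_def
  proof (intro conjI allI impI)
    show "C \<subseteq> topspace X" by (simp add: C_def)
    obtain Q where "Q \<in> \<D>"
      using fD by (auto simp: filtered_def)
    then show "C \<noteq> {}"
      using noU Qs saturated_in_subset unfolding C_def by fastforce
    fix D E assume DE: "closedin X D \<and> closedin X E \<and> C \<subseteq> D \<union> E"
    show "C \<subseteq> D \<or> C \<subseteq> E"
    proof (rule ccontr)
      assume "\<not> (C \<subseteq> D \<or> C \<subseteq> E)"
      then obtain Q Q' where QQ: "Q \<in> \<D>" "Q \<subseteq> U \<union> (topspace X - D)" "Q' \<in> \<D>" "Q' \<subseteq> U \<union> (topspace X - E)"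
        using big DE by meson
      then obtain R where "R \<in> \<D>" "R \<subseteq> Q" "R \<subseteq> Q'"
        using fD unfolding filtered_def by blast
      \<comment> \<open>A point of \<open>R\<close> outside \<open>U\<close> would lie in
        \<open>C\<close> but in neither \<open>D\<close> nor \<open>E\<close>.\<close>
      moreover have "R \<subseteq> U" if "R \<subseteq> Q" "R \<subseteq> Q'"
        using that QQ DE unfolding C_def by blast
      ultimately show False using noU by blast
    qed
  qed
  then obtain x where x: "x \<in> topspace X" "C = X closure_of {x}"
    using qs clC unfolding quasisober_def by blast
  \<comment> \<open>Otherwise an open \<open>H\<close> around \<open>Q\<close> misses
    \<open>x\<close>, hence misses the closure \<open>C\<close>, and \<open>Q\<close> lies in
    \<open>U\<close>.\<close>
  have "x \<in> Q" if Q: "Q \<in> \<D>" for Q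
  proof (rule ccontr)
    assume "x \<notin> Q"
    then obtain H where H: "openin X H" "Q \<subseteq> H" "x \<notin> H"
      using saturated_in_openD[OF Qs[OF Q] x(1)] by blast
    have "C \<subseteq> topspace X - H"
      unfolding x(2) using H x(1) by (intro closure_of_minimal) auto
    then show False
      using H(2) noU[OF Q] saturated_in_subset[OF Qs[OF Q]] unfolding C_def by blast
  qed
  then have "x \<in> U" using G(2) U(2) by blast
  moreover have "x \<in> C"
    unfolding x(2) using x(1) by (auto simp: in_closure_of)
  ultimately show False by (simp add: C_def)
qed

text \<open>By well-filteredness an open cover of the intersection covers a single member of \<D>,
  which is compact.\<close>

lemma quasisober_Inter_compact_saturated:
  assumes qs: "quasisober X" and DQ: "\<D> \<subseteq> compact_saturated X" and fD: "filtered \<D>"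
  shows "\<Inter>\<D> \<in> compact_saturated X"
proof -
  have ne: "\<D> \<noteq> {}" using fD by (simp add: filtered_def)
  have sat: "saturated_in X (\<Inter>\<D>)"
    using ne DQ by (intro saturated_in_Inter) (auto simp: compact_saturated_def)
  moreover have "\<exists>\<F>. finite \<F> \<and> \<F> \<subseteq> \<U> \<and> \<Inter>\<D> \<subseteq> \<Union>\<F>"
    if \<U>: "\<forall>U\<in>\<U>. openin X U" "\<Inter>\<D> \<subseteq> \<Union>\<U>" for \<U>
  proof -
    obtain Q where Q: "Q \<in> \<D>" "Q \<subseteq> \<Union>\<U>"
      using quasisober_well_filtered[OF qs DQ fD, of "\<Union>\<U>"] \<U> by blast
    then have "compactin X Q"
      using DQ by (auto simp: compact_saturated_def)
    then obtain \<F> where "finite \<F>" "\<F> \<subseteq> \<U>" "Q \<subseteq> \<Union>\<F>"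
      using Q \<U> unfolding compactin_def by blast
    then show ?thesis using Q(1) by blast
  qed
  ultimately show ?thesis
    using saturated_in_subset[OF sat] unfolding compact_saturated_def compactin_def by blast
qed

section \<open>Borel sets and their atoms\<close>

lemma sigma_algebra_borel_sets: "sigma_algebra (topspace X) (borel_sets X)"
  unfolding borel_sets_def
  by (rule sigma_algebra_sigma_sets) (auto simp: compact_saturated_def dest: openin_subset saturated_in_subset)

lemma borel_sets_subset:
  assumes "B \<in> borel_sets X" shows "B \<subseteq> topspace X"
proof -
  interpret sigma_algebra "topspace X" "borel_sets X"
    by (rule sigma_algebra_borel_sets)
  show ?thesis using assms by (rule sets_into_space)
qed

lemma openin_borel_sets: "openin X G \<Longrightarrow> G \<in> borel_sets X"
  by (simp add: borel_sets_def sigma_sets.Basic)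

lemma closedin_borel_sets:
  assumes "closedin X C" shows "C \<in> borel_sets X"
proof -
  interpret sigma_algebra "topspace X" "borel_sets X"
    by (rule sigma_algebra_borel_sets)
  have "topspace X - (topspace X - C) \<in> borel_sets X"
    using assms by (intro compl_sets openin_borel_sets) auto
  then show ?thesis
    using closedin_subset[OF assms] by (simp add: double_diff)
qed

lemma compact_saturated_borel_sets: "Q \<in> compact_saturated X \<Longrightarrow> Q \<in> borel_sets X"
  by (simp add: borel_sets_def sigma_sets.Basic)

lemma borel_sets_Int:
  assumes "A \<in> borel_sets X" "B \<in> borel_sets X" shows "A \<inter> B \<in> borel_sets X"
proof -
  interpret sigma_algebra "topspace X" "borel_sets X"
    by (rule sigma_algebra_borel_sets)
  show ?thesis using assms by (rule Int)
qed

lemma borel_sets_countable_Union: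
  "countable \<A> \<Longrightarrow> \<A> \<subseteq> borel_sets X \<Longrightarrow> \<Union>\<A> \<in> borel_sets X"
  using sigma_algebra_borel_sets sigma_algebra.countable_Union by blast

lemma saturation_borel_sets: "compactin X K \<Longrightarrow> saturation X K \<in> borel_sets X"
  by (simp add: compact_saturated_borel_sets saturation_compact_saturated)

lemma compact_saturated_compact_borel:
  assumes "Q \<in> compact_saturated X" shows "Q \<in> compact_borel X"
  using assms compact_saturated_borel_sets[OF assms] by (simp add: compact_borel_def compact_saturated_def)

text \<open>For \<open>x\<close> in the space, the class of points topologically indistinguishable
  from \<open>x\<close>. Singletons need not be Borel; a closed set meeting a compact saturated set
  is visibly compact and Borel.\<close>

definition borel_atom :: "'e topology \<Rightarrow> 'e \<Rightarrow> 'e set" where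
  "borel_atom X x = X closure_of {x} \<inter> saturation X {x}"

lemma borel_atom_iff:
  assumes "x \<in> topspace X"
  shows "y \<in> borel_atom X x \<longleftrightarrow> y \<in> topspace X \<and> (\<forall>G. openin X G \<longrightarrow> x \<in> G \<longleftrightarrow> y \<in> G)"
proof -
  have "y \<in> X closure_of {x} \<longleftrightarrow> y \<in> topspace X \<and> (\<forall>G. openin X G \<and> y \<in> G \<longrightarrow> x \<in> G)"
    by (auto simp: in_closure_of)
  moreover have "y \<in> saturation X {x} \<longleftrightarrow> (\<forall>G. openin X G \<and> x \<in> G \<longrightarrow> y \<in> G)"
    by (auto simp: saturation_def)
  ultimately show ?thesis
    unfolding borel_atom_def by blast
qed

lemma borel_atom_self: "x \<in> topspace X \<Longrightarrow> x \<in> borel_atom X x"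
  by (simp add: borel_atom_iff)

lemma borel_atom_subset_open_iff:
  "x \<in> topspace X \<Longrightarrow> openin X G \<Longrightarrow> borel_atom X x \<subseteq> G \<longleftrightarrow> x \<in> G"
  using borel_atom_iff borel_atom_self by (metis subset_iff)

lemma borel_atom_compact_borel:
  assumes x: "x \<in> topspace X"
  shows "borel_atom X x \<in> compact_borel X"
proof -
  have "compactin X (saturation X {x})"
    using x by (simp add: compactin_iff_saturation finite_imp_compactin)
  then have "compactin X (borel_atom X x)"
    unfolding borel_atom_def by (intro closed_Int_compactin) auto
  moreover have "borel_atom X x \<in> borel_sets X"
    unfolding borel_atom_def using x
    by (intro borel_sets_Int closedin_borel_sets saturation_borel_sets) (auto simp: finite_imp_compactin)
  ultimately show ?thesis by (simp add: compact_borel_def)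
qed

lemma borel_atom_borel_sets: "x \<in> topspace X \<Longrightarrow> borel_atom X x \<in> borel_sets X"
  using borel_atom_compact_borel[of x X] by (simp add: compact_borel_def)

text \<open>Induction over the generated \<sigma>-algebra: all generators are saturated, and
  complements are handled by the symmetry of topological indistinguishability.\<close>

lemma borel_atom_subset:
  assumes "B \<in> borel_sets X" "x \<in> B"
  shows "borel_atom X x \<subseteq> B"
  using assms unfolding borel_sets_def
proof (induction arbitrary: x rule: sigma_sets.induct)
  case (Basic A)
  have sat: "saturated_in X A"
  proof (cases "openin X A")
    case True
    then show ?thesis
      unfolding saturated_in_def using openin_subset by (intro exI[of _ "{A}"]) fastforce
  next
    case False
    then show ?thesis using Basic.hyps by (simp add: compact_saturated_def)
  qed
  have xX: "x \<in> topspace X"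
    using Basic.prems saturated_in_subset[OF sat] by auto
  show ?case
  proof
    fix y assume "y \<in> borel_atom X x"
    then have y: "y \<in> topspace X" "\<And>G. openin X G \<Longrightarrow> x \<in> G \<longleftrightarrow> y \<in> G"
      using borel_atom_iff[OF xX] by auto
    show "y \<in> A"
    proof (rule ccontr)
      assume "y \<notin> A"
      then obtain G where "openin X G" "A \<subseteq> G" "y \<notin> G"
        using saturated_in_openD[OF sat y(1)] by auto
      then show False using y(2) Basic.prems by auto
    qed
  qed
next
  case Empty
  then show ?case by simp
next
  case (Compl A)
  then have xX: "x \<in> topspace X" "x \<notin> A" by auto
  show ?case
  proof
    fix y assume "y \<in> borel_atom X x"
    then have "y \<in> topspace X" and "\<And>G. openin X G \<Longrightarrow> x \<in> G \<longleftrightarrow> y \<in> G"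
      using borel_atom_iff[OF xX(1)] by auto
    then have y: "y \<in> topspace X" "x \<in> borel_atom X y"
      using xX(1) by (simp_all add: borel_atom_iff)
    then show "y \<in> topspace X - A"
      using Compl.IH[of y] xX(2) by auto
  qed
next
  case (Union A)
  then obtain i where "x \<in> A i" by auto
  then show ?case using Union.IH[of x i] by auto
qed

lemma borel_set_eq_Union_atoms:
  assumes "B \<in> borel_sets X"
  shows "\<Union>(borel_atom X ` B) = B"
proof
  show "\<Union>(borel_atom X ` B) \<subseteq> B"
    using borel_atom_subset[OF assms] by auto
  show "B \<subseteq> \<Union>(borel_atom X ` B)"
  proof
    fix x assume "x \<in> B"
    then show "x \<in> \<Union>(borel_atom X ` B)"
      using borel_atom_self[of x X] borel_sets_subset[OF assms] by auto
  qed
qed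

section \<open>Maxitive measures with values in a domain\<close>

lemma completely_maxitive_isLub:
  "completely_maxitive X \<nu> \<Longrightarrow> \<A> \<subseteq> borel_sets X \<Longrightarrow> \<Union>\<A> \<in> borel_sets X \<Longrightarrow>
    isLub UNIV (\<nu> ` \<A>) (\<nu> (\<Union>\<A>))"
  by (simp add: completely_maxitive_def)

lemma completely_maxitive_imp_sigma_maxitive: "completely_maxitive X \<nu> \<Longrightarrow> sigma_maxitive X \<nu>"
  by (simp add: completely_maxitive_def sigma_maxitive_def)

text \<open>A supremum over a union is the supremum of the suprema over its pieces.\<close>

lemma cardinal_density_imp_completely_maxitive:
  assumes "cardinal_density X \<nu> c"
  shows "completely_maxitive X \<nu>"
  unfolding completely_maxitive_def
proof (intro conjI allI impI)
  have lub: "isLub UNIV (c ` B) (\<nu> B)" if "B \<in> borel_sets X" for B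
    using assms that by (simp add: cardinal_density_def)
  have ub: "c x \<le> \<nu> B" if "B \<in> borel_sets X" "x \<in> B" for B x
    using lub[OF that(1)] that(2) by (simp add: isLub_UNIV_iff)
  have least: "\<nu> B \<le> u" if "B \<in> borel_sets X" "\<And>x. x \<in> B \<Longrightarrow> c x \<le> u" for B u
    using lub[OF that(1)] that(2) by (simp add: isLub_UNIV_iff)
  show "\<nu> {} = bot"
    by (rule bot_unique[THEN iffD1], rule least) (simp_all add: openin_borel_sets)
  fix \<A> assume A: "\<A> \<subseteq> borel_sets X \<and> \<Union>\<A> \<in> borel_sets X"
  show "isLub UNIV (\<nu> ` \<A>) (\<nu> (\<Union>\<A>))"
    unfolding isLub_UNIV_iff
  proof (intro conjI ballI allI impI)
    fix a assume "a \<in> \<nu> ` \<A>"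
    then obtain B where B: "B \<in> \<A>" "a = \<nu> B" by auto
    show "a \<le> \<nu> (\<Union>\<A>)"
      unfolding B(2) by (rule least) (use A B(1) ub in auto)
  next
    fix u assume u: "\<forall>a\<in>\<nu> ` \<A>. a \<le> u"
    show "\<nu> (\<Union>\<A>) \<le> u"
    proof (rule least)
      fix x assume "x \<in> \<Union>\<A>"
      then obtain B where "B \<in> \<A>" "x \<in> B" by auto
      then show "c x \<le> u"
        using ub[of B x] A u by (auto intro: order_trans)
    qed (use A in simp)
  qed
qed

text \<open>A Borel set is the union of the atoms of its points.\<close>

lemma completely_maxitive_imp_cardinal_density:
  assumes "completely_maxitive X \<nu>"
  shows "cardinal_density X \<nu> (\<lambda>x. \<nu> (borel_atom X x))"
  unfolding cardinal_density_def
proof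
  fix B assume B: "B \<in> borel_sets X"
  have "borel_atom X ` B \<subseteq> borel_sets X"
    using borel_sets_subset[OF B] by (auto intro: borel_atom_borel_sets)
  then have "isLub UNIV (\<nu> ` borel_atom X ` B) (\<nu> (\<Union>(borel_atom X ` B)))"
    using B by (intro completely_maxitive_isLub[OF assms]) (simp_all add: borel_set_eq_Union_atoms)
  then show "isLub UNIV ((\<lambda>x. \<nu> (borel_atom X x)) ` B) (\<nu> B)"
    using B by (simp add: borel_set_eq_Union_atoms image_image)
qed

text \<open>Only open supersets enter \<open>outer_ext\<close>, so it cannot tell a set from its
  saturation or a point from its atom.\<close>

lemma outer_ext_cong:
  "(\<And>G. openin X G \<Longrightarrow> A \<subseteq> G \<longleftrightarrow> B \<subseteq> G) \<Longrightarrow> outer_ext X \<nu> A = outer_ext X \<nu> B"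
  unfolding outer_ext_def by (simp cong: conj_cong)

lemma outer_ext_saturation: "outer_ext X \<nu> (saturation X A) = outer_ext X \<nu> A"
  by (rule outer_ext_cong) (rule saturation_subset_iff)

lemma outer_ext_borel_atom:
  "x \<in> topspace X \<Longrightarrow> outer_ext X \<nu> (borel_atom X x) = outer_ext X \<nu> {x}"
  by (rule outer_ext_cong) (simp add: borel_atom_subset_open_iff)

locale domain_maxitive =
  fixes X :: "'e topology" and \<nu> :: "'e set \<Rightarrow> 'l::order_bot"
  assumes dom: "poset_domain TYPE('l)" and max: "maxitive X \<nu>"
begin

lemma measure_finite_Union_le:
  assumes fin: "finite \<A>" and A: "\<A> \<subseteq> borel_sets X" and le: "\<And>A. A \<in> \<A> \<Longrightarrow> \<nu> A \<le> s"
  shows "\<nu> (\<Union>\<A>) \<le> s"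
proof -
  have "\<Union>\<A> \<in> borel_sets X"
    using borel_sets_countable_Union[OF countable_finite[OF fin] A] .
  then have "isLub UNIV (\<nu> ` \<A>) (\<nu> (\<Union>\<A>))"
    using max fin A by (simp add: maxitive_def)
  then show ?thesis
    using le by (simp add: isLub_UNIV_iff)
qed

lemma measure_mono:
  assumes "A \<in> borel_sets X" "B \<in> borel_sets X" "A \<subseteq> B"
  shows "\<nu> A \<le> \<nu> B"
proof -
  have "\<Union>{A, B} = B" using assms(3) by auto
  then have "isLub UNIV (\<nu> ` {A, B}) (\<nu> B)"
    using max assms(1,2) unfolding maxitive_def by (metis empty_subsetI finite.emptyI finite.insertI insert_subset)
  then show ?thesis by (simp add: isLub_UNIV_iff)
qed

section \<open>The outer extension and its values at points\<close>

lemma outer_ext_glb: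
  "B \<subseteq> topspace X \<Longrightarrow> isGlb UNIV (\<nu> ` {G. openin X G \<and> B \<subseteq> G}) (outer_ext X \<nu> B)"
  by (rule outer_ext_isGlb[OF dom max])

lemma outer_ext_le:
  assumes "openin X G" "B \<subseteq> G"
  shows "outer_ext X \<nu> B \<le> \<nu> G"
  using outer_ext_glb[of B] openin_subset[OF assms(1)] assms by (auto simp: isGlb_UNIV_iff)

lemma outer_ext_greatest:
  assumes "B \<subseteq> topspace X" "\<And>G. openin X G \<Longrightarrow> B \<subseteq> G \<Longrightarrow> l \<le> \<nu> G"
  shows "l \<le> outer_ext X \<nu> B"
  using outer_ext_glb[OF assms(1)] assms(2) by (auto simp: isGlb_UNIV_iff)

lemma measure_le_outer_ext: "B \<in> borel_sets X \<Longrightarrow> \<nu> B \<le> outer_ext X \<nu> B"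
  by (rule outer_ext_greatest) (simp_all add: borel_sets_subset measure_mono openin_borel_sets)

text \<open>The values on open supersets of \<open>B\<close> form a filtered set, since open sets
  are stable under intersection; an element way above their infimum dominates one of them.\<close>

lemma outer_ext_way_above:
  assumes B: "B \<subseteq> topspace X" and s: "s \<ggreater> outer_ext X \<nu> B"
  obtains G where "openin X G" "B \<subseteq> G" "\<nu> G \<le> s"
proof -
  define A where "A = \<nu> ` {G. openin X G \<and> B \<subseteq> G}"
  have "\<exists>t\<in>A. t \<le> a \<and> t \<le> b" if ab: "a \<in> A" "b \<in> A" for a b
  proof -
    obtain G H where GH: "openin X G" "B \<subseteq> G" "a = \<nu> G" "openin X H" "B \<subseteq> H" "b = \<nu> H"
      using ab unfolding A_def by auto
    then have "\<nu> (G \<inter> H) \<in> A" "\<nu> (G \<inter> H) \<le> a" "\<nu> (G \<inter> H) \<le> b"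
      unfolding A_def by (auto intro!: measure_mono openin_borel_sets)
    then show ?thesis by auto
  qed
  moreover have "A \<noteq> {}"
    using B unfolding A_def by auto
  ultimately have "filtered A"
    unfolding filtered_def by simp
  then obtain a where "a \<in> A" "a \<le> s"
    using way_above_filtered[OF s _ outer_ext_glb[OF B, folded A_def] order_refl] by auto
  then show thesis
    using that unfolding A_def by auto
qed

text \<open>Local input for covering arguments: where the outer extension at points is bounded by
  \<open>u\<close>, each point has an open neighbourhood of measure at most
  \<open>s\<close>.\<close>

lemma outer_ext_singleton_way_above:
  assumes "x \<in> topspace X" "outer_ext X \<nu> {x} \<le> u" "s \<ggreater> u"
  obtains G where "openin X G" "x \<in> G" "\<nu> G \<le> s"
proof -
  have "s \<ggreater> outer_ext X \<nu> {x}"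
    using assms(2,3) way_above_ge_trans by auto
  then show thesis
    using outer_ext_way_above[of "{x}" s] assms(1) that by auto
qed

lemma usc_outer_ext: "usc X (\<lambda>x. outer_ext X \<nu> {x})"
  unfolding usc_def
proof
  fix t
  show "openin X {x \<in> topspace X. t \<ggreater> outer_ext X \<nu> {x}}"
  proof (subst openin_subopen, intro ballI)
    fix x assume "x \<in> {x \<in> topspace X. t \<ggreater> outer_ext X \<nu> {x}}"
    then have x: "x \<in> topspace X" "t \<ggreater> outer_ext X \<nu> {x}" by auto
    \<comment> \<open>Neighbourhoods only give a bound by \<open>\<le>\<close>; the interpolant
      \<open>t'\<close> turns it back into \<open>t\<close> being way above the nearby
      values.\<close>
    obtain t' where t': "t \<ggreater> t'" "t' \<ggreater> outer_ext X \<nu> {x}"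
      using way_above_interpolation[OF dom x(2)] by auto
    obtain G where G: "openin X G" "x \<in> G" "\<nu> G \<le> t'"
      using outer_ext_singleton_way_above[OF x(1) order_refl t'(2)] by auto
    have "t \<ggreater> outer_ext X \<nu> {y}" if "y \<in> G" for y
      using t'(1) G(3) outer_ext_le[OF G(1), of "{y}"] that
      by (auto intro: way_above_ge_trans order_trans)
    then have "G \<subseteq> {x \<in> topspace X. t \<ggreater> outer_ext X \<nu> {x}}"
      using openin_subset[OF G(1)] by auto
    then show "\<exists>T. openin X T \<and> x \<in> T \<and> T \<subseteq> {x \<in> topspace X. t \<ggreater> outer_ext X \<nu> {x}}"
      using G(1,2) by auto
  qed
qed

text \<open>Finitely many open sets of measure at most \<open>s\<close> cover \<open>K\<close>, and
  maxitivity bounds their union by \<open>s\<close>.\<close>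

lemma outer_ext_compact_le:
  assumes K: "compactin X K" and u: "\<And>x. x \<in> K \<Longrightarrow> outer_ext X \<nu> {x} \<le> u"
  shows "outer_ext X \<nu> K \<le> u"
proof (rule le_if_le_way_above[OF dom])
  fix s assume s: "s \<ggreater> u"
  define \<U> where "\<U> = {G. openin X G \<and> \<nu> G \<le> s}"
  have "\<forall>U\<in>\<U>. openin X U" by (simp add: \<U>_def)
  moreover have "K \<subseteq> \<Union>\<U>"
  proof
    fix x assume x: "x \<in> K"
    then obtain G where "openin X G" "x \<in> G" "\<nu> G \<le> s"
      using outer_ext_singleton_way_above[OF _ u[OF x] s] compactin_subset_topspace[OF K] by auto
    then show "x \<in> \<Union>\<U>" by (auto simp: \<U>_def)
  qed
  ultimately obtain \<F> where F: "finite \<F>" "\<F> \<subseteq> \<U>" "K \<subseteq> \<Union>\<F>"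
    using compactinD[OF K, of \<U>] by auto
  have "outer_ext X \<nu> K \<le> \<nu> (\<Union>\<F>)"
    using F by (intro outer_ext_le openin_Union) (auto simp: \<U>_def)
  also have "\<dots> \<le> s"
    using F(1,2) by (intro measure_finite_Union_le) (auto simp: \<U>_def openin_borel_sets)
  finally show "outer_ext X \<nu> K \<le> s" .
qed

section \<open>Densities\<close>

text \<open>The candidate is the outer extension at singletons. Weak outer-continuity makes \<nu> an
  upper bound for it; \<open>fine\<close> isolates leastness, which is proved differently under each
  hypothesis.\<close>

lemma usc_densityI:
  assumes woc: "weakly_outer_continuous X \<nu>"
    and fine: "\<And>B s u. \<lbrakk>B \<in> borel_sets X; \<And>x. x \<in> B \<Longrightarrow> outer_ext X \<nu> {x} \<le> u; s \<ggreater> u\<rbrakk> \<Longrightarrow> \<nu> B \<le> s"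
  shows "\<exists>c. usc X c \<and> cardinal_density X \<nu> c"
proof (intro exI conjI)
  show "usc X (\<lambda>x. outer_ext X \<nu> {x})"
    by (rule usc_outer_ext)
  show "cardinal_density X \<nu> (\<lambda>x. outer_ext X \<nu> {x})"
    unfolding cardinal_density_def
  proof
    fix B assume B: "B \<in> borel_sets X"
    show "isLub UNIV ((\<lambda>x. outer_ext X \<nu> {x}) ` B) (\<nu> B)"
    proof (rule isLub_if_le_way_above[OF dom])
      fix a assume "a \<in> (\<lambda>x. outer_ext X \<nu> {x}) ` B"
      then obtain x where x: "x \<in> B" "a = outer_ext X \<nu> {x}" by auto
      have xX: "x \<in> topspace X"
        using x(1) borel_sets_subset[OF B] by auto
      \<comment> \<open>The atom is compact Borel with the same open supersets as
        \<open>{x}\<close>, so weak outer-continuity applies to it even if \<open>{x}\<close> is not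
        Borel.\<close>
      have "a = \<nu> (borel_atom X x)"
        using x(2) woc borel_atom_compact_borel[OF xX] outer_ext_borel_atom[OF xX, of \<nu>]
        by (simp add: weakly_outer_continuous_def)
      also have "\<dots> \<le> \<nu> B"
        by (intro measure_mono borel_atom_borel_sets xX B borel_atom_subset x)
      finally show "a \<le> \<nu> B" .
    next
      fix u s
      assume u: "\<And>a. a \<in> (\<lambda>x. outer_ext X \<nu> {x}) ` B \<Longrightarrow> a \<le> u" and s: "s \<ggreater> u"
      show "\<nu> B \<le> s"
        by (rule fine[OF B _ s]) (intro u imageI)
    qed
  qed
qed

section \<open>Consequences of usc densities and of weak outer-continuity\<close>

text \<open>For \<open>s \<ggreater> \<nu> B\<close> the points where \<open>s\<close> is way above
  the density form an open superset of \<open>B\<close>, whose measure is a supremum of values at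
  most \<open>s\<close>.\<close>

lemma usc_density_imp_outer_continuous:
  assumes c: "usc X c" and d: "cardinal_density X \<nu> c"
  shows "outer_continuous X \<nu>"
  unfolding outer_continuous_def
proof
  fix B assume B: "B \<in> borel_sets X"
  have lub: "isLub UNIV (c ` A) (\<nu> A)" if "A \<in> borel_sets X" for A
    using d that by (simp add: cardinal_density_def)
  have "outer_ext X \<nu> B \<le> \<nu> B"
  proof (rule le_if_le_way_above[OF dom])
    fix s assume s: "s \<ggreater> \<nu> B"
    define G where "G = {x \<in> topspace X. s \<ggreater> c x}"
    have G: "openin X G"
      using c by (simp add: usc_def G_def)
    have "c x \<le> \<nu> B" if "x \<in> B" for x
      using lub[OF B] that by (simp add: isLub_UNIV_iff)
    then have "B \<subseteq> G"
      using borel_sets_subset[OF B] way_above_ge_trans[OF s] by (auto simp: G_def)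
    then have "outer_ext X \<nu> B \<le> \<nu> G"
      by (rule outer_ext_le[OF G])
    also have "\<nu> G \<le> s"
      using lub[OF openin_borel_sets[OF G]] by (auto simp: isLub_UNIV_iff G_def way_above_imp_ge)
    finally show "outer_ext X \<nu> B \<le> s" .
  qed
  then show "\<nu> B = outer_ext X \<nu> B"
    using measure_le_outer_ext[OF B] by (rule antisym[rotated])
qed

lemma outer_continuous_imp_weakly: "outer_continuous X \<nu> \<Longrightarrow> weakly_outer_continuous X \<nu>"
  by (simp add: outer_continuous_def weakly_outer_continuous_def compact_borel_def)

text \<open>\<open>K\<close> and its saturation are both compact Borel and have the same open
  supersets.\<close>

lemma weakly_outer_continuous_imp_saturated:
  assumes "weakly_outer_continuous X \<nu>"
  shows "saturated_measure X \<nu>"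
  unfolding saturated_measure_def
proof
  fix K assume K: "K \<in> compact_borel X"
  then have "saturation X K \<in> compact_borel X"
    by (intro compact_saturated_compact_borel saturation_compact_saturated) (simp add: compact_borel_def)
  then show "\<nu> K = \<nu> (saturation X K)"
    using K assms by (simp add: weakly_outer_continuous_def outer_ext_saturation)
qed

text \<open>By well-filteredness every open set around the intersection contains a member of \<D>,
  so lower bounds of \<nu> on \<D> are lower bounds on these open sets.\<close>

lemma weakly_outer_continuous_imp_Q_smooth:
  assumes qs: "quasisober X" and woc: "weakly_outer_continuous X \<nu>"
  shows "Q_smooth X \<nu>"
  unfolding Q_smooth_def
proof (intro allI impI, elim conjE)
  fix \<D> assume D: "\<D> \<subseteq> compact_saturated X" "filtered \<D>"
  have Q: "\<Inter>\<D> \<in> compact_saturated X"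
    by (rule quasisober_Inter_compact_saturated[OF qs D])
  then have eq: "\<nu> (\<Inter>\<D>) = outer_ext X \<nu> (\<Inter>\<D>)"
    using woc compact_saturated_compact_borel by (auto simp: weakly_outer_continuous_def)
  have sub: "\<Inter>\<D> \<subseteq> topspace X"
    by (rule borel_sets_subset[OF compact_saturated_borel_sets[OF Q]])
  have DB: "Q \<in> borel_sets X" if "Q \<in> \<D>" for Q
    using that D(1) compact_saturated_borel_sets by auto
  show "isGlb UNIV (\<nu> ` \<D>) (\<nu> (\<Inter>\<D>))"
    unfolding isGlb_UNIV_iff
  proof (intro conjI ballI allI impI)
    fix a assume "a \<in> \<nu> ` \<D>"
    then obtain R where R: "R \<in> \<D>" "a = \<nu> R" by auto
    show "\<nu> (\<Inter>\<D>) \<le> a"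
      unfolding R(2) using R(1) by (intro measure_mono compact_saturated_borel_sets[OF Q] DB) auto
  next
    fix l assume l: "\<forall>a\<in>\<nu> ` \<D>. l \<le> a"
    show "l \<le> \<nu> (\<Inter>\<D>)"
      unfolding eq
    proof (rule outer_ext_greatest[OF sub])
      fix G assume G: "openin X G" "\<Inter>\<D> \<subseteq> G"
      then obtain R where R: "R \<in> \<D>" "R \<subseteq> G"
        using quasisober_well_filtered[OF qs D G] by auto
      then have "l \<le> \<nu> R" using l by simp
      also have "\<dots> \<le> \<nu> G"
        by (intro measure_mono DB openin_borel_sets R G)
      finally show "l \<le> \<nu> G" .
    qed
  qed
qed

section \<open>Inner continuity, complete maxitivity and usc densities\<close>

text \<open>Inner-continuity reduces the bound to saturations of compact sets \<open>K\<close>, and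
  outer-continuity identifies their measure with the outer extension of \<open>K\<close>, which is
  controlled pointwise.\<close>

lemma regular_imp_usc_density:
  assumes "regular_maxitive X \<nu>"
  shows "\<exists>c. usc X c \<and> cardinal_density X \<nu> c"
proof (rule usc_densityI)
  have ic: "inner_continuous X \<nu>" and oc: "outer_continuous X \<nu>"
    using assms by (simp_all add: regular_maxitive_def)
  show "weakly_outer_continuous X \<nu>"
    by (rule outer_continuous_imp_weakly[OF oc])
  fix B s u
  assume B: "B \<in> borel_sets X" and u: "\<And>x. x \<in> B \<Longrightarrow> outer_ext X \<nu> {x} \<le> u" and s: "s \<ggreater> u"
  have "\<nu> (saturation X K) \<le> u" if K: "K \<in> compact_borel X" "K \<subseteq> B" for K
  proof -
    have cK: "compactin X K" using K(1) by (simp add: compact_borel_def)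
    then have "\<nu> (saturation X K) = outer_ext X \<nu> K"
      using oc saturation_borel_sets[OF cK] by (simp add: outer_continuous_def outer_ext_saturation)
    then show ?thesis
      using outer_ext_compact_le[OF cK] u K(2) by auto
  qed
  then have "\<nu> B \<le> u"
    using ic B by (auto simp: inner_continuous_def isLub_UNIV_iff)
  then show "\<nu> B \<le> s"
    using way_above_imp_ge[OF s] by (rule order_trans)
qed

text \<open>Weak inner-continuity speaks of open sets only, so \<open>B\<close> is first enlarged to
  the open set \<open>G\<close> on which \<open>s\<close> is way above the density.\<close>

lemma weakly_continuous_imp_usc_density:
  assumes woc: "weakly_outer_continuous X \<nu>" and wic: "weakly_inner_continuous X \<nu>"
  shows "\<exists>c. usc X c \<and> cardinal_density X \<nu> c"
proof (rule usc_densityI[OF woc])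
  fix B s u
  assume B: "B \<in> borel_sets X" and u: "\<And>x. x \<in> B \<Longrightarrow> outer_ext X \<nu> {x} \<le> u" and s: "s \<ggreater> u"
  define G where "G = {x \<in> topspace X. s \<ggreater> outer_ext X \<nu> {x}}"
  have G: "openin X G"
    using usc_outer_ext by (simp add: usc_def G_def)
  have "outer_ext X \<nu> K \<le> s" if "K \<in> compact_borel X" "K \<subseteq> G" for K
  proof (rule outer_ext_compact_le)
    show "compactin X K"
      using that(1) by (simp add: compact_borel_def)
    fix x assume "x \<in> K"
    then have "s \<ggreater> outer_ext X \<nu> {x}"
      using that(2) by (auto simp: G_def)
    then show "outer_ext X \<nu> {x} \<le> s"
      by (rule way_above_imp_ge)
  qed
  then have "\<nu> G \<le> s"
    using wic G by (auto simp: weakly_inner_continuous_def isLub_UNIV_iff)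
  moreover have "B \<subseteq> G"
    using borel_sets_subset[OF B] u s by (auto simp: G_def intro: way_above_ge_trans)
  then have "\<nu> B \<le> \<nu> G"
    by (intro measure_mono B openin_borel_sets G)
  ultimately show "\<nu> B \<le> s" by simp
qed

text \<open>The compact Borel subsets of \<open>B\<close> include the atoms of its points and
  therefore cover \<open>B\<close>.\<close>

lemma completely_maxitive_compact_isLub:
  assumes cm: "completely_maxitive X \<nu>" and B: "B \<in> borel_sets X"
  shows "isLub UNIV (\<nu> ` {K \<in> compact_borel X. K \<subseteq> B}) (\<nu> B)"
proof -
  have "\<Union>{K \<in> compact_borel X. K \<subseteq> B} = B"
  proof
    show "B \<subseteq> \<Union>{K \<in> compact_borel X. K \<subseteq> B}"
    proof
      fix x assume "x \<in> B"
      then show "x \<in> \<Union>{K \<in> compact_borel X. K \<subseteq> B}"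
        using borel_sets_subset[OF B] borel_atom_self[of x X] borel_atom_compact_borel[of x X]
          borel_atom_subset[OF B] by auto
    qed
  qed auto
  then show ?thesis
    using completely_maxitive_isLub[OF cm, of "{K \<in> compact_borel X. K \<subseteq> B}"] B
    by (auto simp: compact_borel_def)
qed

lemma outer_continuous_completely_maxitive_imp_regular:
  assumes oc: "outer_continuous X \<nu>" and cm: "completely_maxitive X \<nu>"
  shows "regular_maxitive X \<nu>"
proof -
  have "saturated_measure X \<nu>"
    by (intro weakly_outer_continuous_imp_saturated outer_continuous_imp_weakly oc)
  then have eq: "(\<lambda>K. \<nu> (saturation X K)) ` {K \<in> compact_borel X. K \<subseteq> B} = \<nu> ` {K \<in> compact_borel X. K \<subseteq> B}" for B
    by (intro image_cong) (simp_all add: saturated_measure_def)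
  show ?thesis
    using oc completely_maxitive_compact_isLub[OF cm]
    by (simp add: regular_maxitive_def inner_continuous_def eq)
qed

lemma outer_continuous_completely_maxitive_imp_weakly_inner:
  assumes oc: "outer_continuous X \<nu>" and cm: "completely_maxitive X \<nu>"
  shows "weakly_inner_continuous X \<nu>"
proof -
  have eq: "outer_ext X \<nu> ` {K \<in> compact_borel X. K \<subseteq> B} = \<nu> ` {K \<in> compact_borel X. K \<subseteq> B}" for B
    using oc by (intro image_cong) (simp_all add: outer_continuous_def compact_borel_def)
  show ?thesis
    using completely_maxitive_compact_isLub[OF cm] openin_borel_sets
    by (auto simp: weakly_inner_continuous_def eq)
qed

text \<open>Countably many basic open sets of measure at most \<open>s\<close> cover
  \<open>B\<close>, and \<sigma>-maxitivity bounds their union.\<close>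

lemma second_countable_imp_usc_density:
  assumes sc: "second_countable X" and woc: "weakly_outer_continuous X \<nu>"
    and sm: "sigma_maxitive X \<nu>"
  shows "\<exists>c. usc X c \<and> cardinal_density X \<nu> c"
proof (rule usc_densityI[OF woc])
  fix B s u
  assume B: "B \<in> borel_sets X" and u: "\<And>x. x \<in> B \<Longrightarrow> outer_ext X \<nu> {x} \<le> u" and s: "s \<ggreater> u"
  obtain \<B> where \<B>: "countable \<B>" "\<And>V. V \<in> \<B> \<Longrightarrow> openin X V"
    "\<And>U x. openin X U \<Longrightarrow> x \<in> U \<Longrightarrow> \<exists>V \<in> \<B>. x \<in> V \<and> V \<subseteq> U"
    using sc unfolding second_countable_def by metis
  define \<V> where "\<V> = {V \<in> \<B>. \<nu> V \<le> s}"
  have VB: "\<V> \<subseteq> borel_sets X" and cV: "countable \<V>"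
    using \<B>(1,2) by (auto simp: \<V>_def openin_borel_sets)
  have UV: "\<Union>\<V> \<in> borel_sets X"
    by (rule borel_sets_countable_Union[OF cV VB])
  have "B \<subseteq> \<Union>\<V>"
  proof
    fix x assume x: "x \<in> B"
    then obtain G where G: "openin X G" "x \<in> G" "\<nu> G \<le> s"
      using outer_ext_singleton_way_above[OF _ u[OF x] s] borel_sets_subset[OF B] by auto
    obtain V where V: "V \<in> \<B>" "x \<in> V" "V \<subseteq> G"
      using \<B>(3)[OF G(1,2)] by auto
    have "\<nu> V \<le> \<nu> G"
      using V \<B>(2)[OF V(1)] G by (intro measure_mono openin_borel_sets)
    then show "x \<in> \<Union>\<V>"
      using V G(3) by (auto simp: \<V>_def)
  qed
  then have "\<nu> B \<le> \<nu> (\<Union>\<V>)"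
    by (intro measure_mono B UV)
  also have "isLub UNIV (\<nu> ` \<V>) (\<nu> (\<Union>\<V>))"
    using sm VB cV UV by (simp add: sigma_maxitive_def)
  then have "\<nu> (\<Union>\<V>) \<le> s"
    by (auto simp: isLub_UNIV_iff \<V>_def)
  finally show "\<nu> B \<le> s" .
qed

section \<open>Locally compact spaces\<close>

text \<open>The compact saturated neighbourhoods of \<open>K\<close> form a filtered family with the
  saturation of \<open>K\<close> as intersection. Thus \<open>\<nu> K\<close> is the infimum of
  their measures, and each contains an open superset of \<open>K\<close>.\<close>

lemma locally_compact_imp_weakly_outer:
  assumes lc: "locally_compact_nbhds X" and qsm: "Q_smooth X \<nu>" and sat: "saturated_measure X \<nu>"
  shows "weakly_outer_continuous X \<nu>"
  unfolding weakly_outer_continuous_def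
proof
  fix K assume K: "K \<in> compact_borel X"
  then have cK: "compactin X K" and KB: "K \<in> borel_sets X"
    by (simp_all add: compact_borel_def)
  define \<D> where "\<D> = {Q \<in> compact_saturated X. \<exists>U. openin X U \<and> K \<subseteq> U \<and> U \<subseteq> Q}"
  have nbhd: "\<exists>Q\<in>\<D>. Q \<subseteq> G" if G: "openin X G" "K \<subseteq> G" for G
  proof -
    \<comment> \<open>These open sets cover \<open>K\<close>; the compact witnesses for a finite
      subcover have a compact union, whose saturation is the desired member of \<D>.\<close>
    define \<U> where "\<U> = {U. openin X U \<and> (\<exists>C. compactin X C \<and> U \<subseteq> C \<and> C \<subseteq> G)}"
    have "\<forall>U\<in>\<U>. openin X U" by (simp add: \<U>_def)
    moreover have "K \<subseteq> \<Union>\<U>"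
    proof
      fix x assume "x \<in> K"
      then obtain U C where "openin X U" "compactin X C" "x \<in> U" "U \<subseteq> C" "C \<subseteq> G"
        using lc G unfolding locally_compact_nbhds_def neighbourhood_base_of by (metis subsetD)
      then show "x \<in> \<Union>\<U>" by (auto simp: \<U>_def)
    qed
    ultimately obtain \<F> where F: "finite \<F>" "\<F> \<subseteq> \<U>" "K \<subseteq> \<Union>\<F>"
      using compactinD[OF cK, of \<U>] by auto
    have "\<forall>U\<in>\<F>. \<exists>C. compactin X C \<and> U \<subseteq> C \<and> C \<subseteq> G"
      using F(2) by (auto simp: \<U>_def)
    then obtain C where C: "\<And>U. U \<in> \<F> \<Longrightarrow> compactin X (C U) \<and> U \<subseteq> C U \<and> C U \<subseteq> G"
      by metis
    have "compactin X (\<Union>(C ` \<F>))"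
      using F(1) C by (intro compactin_Union) auto
    then have Q: "saturation X (\<Union>(C ` \<F>)) \<in> compact_saturated X"
      by (rule saturation_compact_saturated)
    have "\<Union>\<F> \<subseteq> \<Union>(C ` \<F>)"
      using C by (auto intro: UN_I)
    then have "\<Union>\<F> \<subseteq> saturation X (\<Union>(C ` \<F>))"
      using subset_saturation by (rule order_trans)
    moreover have "openin X (\<Union>\<F>)"
      using F(2) by (intro openin_Union) (auto simp: \<U>_def)
    ultimately have "saturation X (\<Union>(C ` \<F>)) \<in> \<D>"
      using F(3) Q by (auto simp: \<D>_def)
    moreover have "saturation X (\<Union>(C ` \<F>)) \<subseteq> G"
      using C by (intro saturation_least G(1)) auto
    ultimately show ?thesis by auto
  qed
  have fD: "filtered \<D>"
    unfolding filtered_def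
  proof (intro conjI ballI)
    show "\<D> \<noteq> {}"
      using nbhd[of "topspace X"] compactin_subset_topspace[OF cK] by auto
    fix Q R assume "Q \<in> \<D>" "R \<in> \<D>"
    then obtain U V where UV: "openin X U" "K \<subseteq> U" "U \<subseteq> Q" "openin X V" "K \<subseteq> V" "V \<subseteq> R"
      by (auto simp: \<D>_def)
    then obtain T where T: "T \<in> \<D>" "T \<subseteq> U \<inter> V"
      using nbhd[of "U \<inter> V"] by auto
    moreover have "T \<subseteq> Q" "T \<subseteq> R"
      using T(2) UV(3,6) by auto
    ultimately show "\<exists>T\<in>\<D>. T \<subseteq> Q \<and> T \<subseteq> R"
      by auto
  qed
  have "\<Inter>\<D> = saturation X K"
  proof
    show "\<Inter>\<D> \<subseteq> saturation X K"
      unfolding saturation_def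
    proof (rule Inter_greatest)
      fix G assume "G \<in> {G. openin X G \<and> K \<subseteq> G}"
      then obtain Q where "Q \<in> \<D>" "Q \<subseteq> G"
        using nbhd[of G] by auto
      then show "\<Inter>\<D> \<subseteq> G" by auto
    qed
    have "saturation X K \<subseteq> Q" if "Q \<in> \<D>" for Q
      using that saturation_least[of X _ K] by (auto simp: \<D>_def)
    then show "saturation X K \<subseteq> \<Inter>\<D>" by auto
  qed
  moreover have "\<D> \<subseteq> compact_saturated X"
    by (auto simp: \<D>_def)
  ultimately have "isGlb UNIV (\<nu> ` \<D>) (\<nu> (saturation X K))"
    using qsm fD unfolding Q_smooth_def by metis
  then have glb: "isGlb UNIV (\<nu> ` \<D>) (\<nu> K)"
    using sat K by (simp add: saturated_measure_def)
  have "outer_ext X \<nu> K \<le> \<nu> Q" if "Q \<in> \<D>" for Q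
  proof -
    obtain U where U: "openin X U" "K \<subseteq> U" "U \<subseteq> Q" and Q: "Q \<in> compact_saturated X"
      using \<open>Q \<in> \<D>\<close> by (auto simp: \<D>_def)
    have "outer_ext X \<nu> K \<le> \<nu> U"
      by (rule outer_ext_le[OF U(1,2)])
    also have "\<dots> \<le> \<nu> Q"
      by (intro measure_mono openin_borel_sets compact_saturated_borel_sets U Q)
    finally show ?thesis .
  qed
  then have "outer_ext X \<nu> K \<le> \<nu> K"
    using glb by (simp add: isGlb_UNIV_iff)
  then show "\<nu> K = outer_ext X \<nu> K"
    using measure_le_outer_ext[OF KB] by simp
qed

end

section \<open>Metrizable spaces\<close>

text \<open>Balls of radius \<open>1 / (n + 1)\<close> centred in a countable dense set form a
  base.\<close>

lemma separable_metrizable_imp_second_countable: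
  assumes "metrizable_space X" "separable_space X"
  shows "second_countable X"
proof -
  obtain M d where "Metric_space M d" and X: "X = Metric_space.mtopology M d"
    using assms(1) by (auto simp: metrizable_space_def)
  then interpret Metric_space M d by simp
  obtain D where D: "countable D" "D \<subseteq> M" "mtopology closure_of D = M"
    using assms(2) by (auto simp: separable_space_def X)
  define \<B> where "\<B> = (\<lambda>(a, n). mball a (inverse (real (Suc n)))) ` (D \<times> UNIV)"
  show ?thesis
    unfolding second_countable_def X
  proof (intro exI[of _ \<B>] conjI ballI allI impI)
    show "countable \<B>"
      using D(1) by (auto simp: \<B>_def)
    show "openin mtopology V" if "V \<in> \<B>" for V
      using that by (auto simp: \<B>_def)
    fix U x assume "openin mtopology U \<and> x \<in> U"
    then have U: "openin mtopology U" "x \<in> U" by auto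
    obtain r where r: "r > 0" "mball x r \<subseteq> U"
      using U by (auto simp: openin_mtopology)
    \<comment> \<open>With radius below \<open>r / 2\<close>, a ball whose centre is within that
      radius of \<open>x\<close> stays inside \<open>mball x r\<close>.\<close>
    obtain n where n: "inverse (real (Suc n)) < r / 2"
      using reals_Archimedean[of "r / 2"] r(1) by auto
    have xM: "x \<in> M" using openin_subset[OF U(1)] U(2) by auto
    then have "x \<in> mtopology closure_of D" using D(3) by simp
    then have "\<forall>r>0. \<exists>a\<in>D. a \<in> mball x r"
      by (simp add: metric_closure_of)
    moreover have "inverse (real (Suc n)) > 0" by simp
    ultimately obtain a where a: "a \<in> D" "a \<in> mball x (inverse (real (Suc n)))"
      by metis
    show "\<exists>V\<in>\<B>. x \<in> V \<and> V \<subseteq> U"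
    proof (intro bexI conjI)
      show "mball a (inverse (real (Suc n))) \<in> \<B>"
        using a(1) by (auto simp: \<B>_def)
      show "x \<in> mball a (inverse (real (Suc n)))"
        using a(2) by (auto simp: commute)
      have "mball a (inverse (real (Suc n))) \<subseteq> mball x r"
        using a(2) n by (intro mball_subset) (auto simp: commute)
      then show "mball a (inverse (real (Suc n))) \<subseteq> U"
        using r(2) by (rule order_trans)
    qed
  qed
qed

lemma t1_space_saturated_in:
  assumes "t1_space X" "A \<subseteq> topspace X"
  shows "saturated_in X A"
  unfolding saturated_in_def
proof (intro exI conjI ballI)
  let ?\<U> = "(\<lambda>y. topspace X - {y}) ` (topspace X - A)"
  show "openin X U" if "U \<in> ?\<U>" for U
    using that assms(1) closedin_t1_singleton by (auto intro!: openin_diff)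
  show "A = topspace X \<inter> \<Inter>?\<U>"
    using assms(2) by auto
qed

text \<open>Lets \<open>Q_smooth\<close> be applied to every filtered family of compact sets once
  points are closed.\<close>

lemma t1_space_compact_saturated:
  "t1_space X \<Longrightarrow> Q \<in> compact_saturated X \<longleftrightarrow> compactin X Q"
  using t1_space_saturated_in[of X Q] compactin_subset_topspace[of X Q]
  by (auto simp: compact_saturated_def)

context domain_maxitive
begin

text \<open>Closed balls around \<open>x\<close> cut \<open>K\<close> in compact sets shrinking to
  \<open>{x}\<close>, so smoothness yields a trace of measure at most \<open>s\<close>; compactness
  leaves finitely many traces.\<close>

lemma metrizable_compact_measure_le:
  assumes met: "metrizable_space X" and qsm: "Q_smooth X \<nu>" and K: "compactin X K"
    and s: "\<And>x. x \<in> K \<Longrightarrow> s \<ggreater> \<nu> {x}"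
  shows "\<nu> K \<le> s"
proof -
  obtain M d where "Metric_space M d" and X: "X = Metric_space.mtopology M d"
    using met by (auto simp: metrizable_space_def)
  then interpret Metric_space M d by simp
  have t1: "t1_space X"
    using met by (simp add: metrizable_imp_t1_space)
  have cpt: "compactin X (mcball x r \<inter> K)" for x r
    using K by (intro closed_Int_compactin) (auto simp: X)
  have borel: "mcball x r \<inter> K \<in> borel_sets X" for x r
    using cpt t1 by (intro compact_saturated_borel_sets) (simp add: t1_space_compact_saturated)
  have ex: "\<exists>r>0. \<nu> (mcball x r \<inter> K) \<le> s" if x: "x \<in> K" for x
  proof -
    have xM: "x \<in> M"
      using compactin_subset_topspace[OF K] x by (auto simp: X)
    define \<D> where "\<D> = (\<lambda>r. mcball x r \<inter> K) ` {0<..}"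
    have "filtered \<D>"
      unfolding filtered_def
    proof (intro conjI ballI)
      show "\<D> \<noteq> {}" by (auto simp: \<D>_def)
      fix Q R assume "Q \<in> \<D>" "R \<in> \<D>"
      then obtain q r where qr: "q > 0" "r > 0" "Q = mcball x q \<inter> K" "R = mcball x r \<inter> K"
        by (auto simp: \<D>_def)
      show "\<exists>T\<in>\<D>. T \<subseteq> Q \<and> T \<subseteq> R"
      proof (intro bexI conjI)
        show "mcball x (min q r) \<inter> K \<in> \<D>"
          using qr(1,2) by (auto simp: \<D>_def)
      qed (auto simp: qr(3,4))
    qed
    moreover have "\<D> \<subseteq> compact_saturated X"
      using cpt t1 by (auto simp: \<D>_def t1_space_compact_saturated)
    moreover have "\<Inter>\<D> = {x}"
    proof
      show "{x} \<subseteq> \<Inter>\<D>"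
        using x xM by (auto simp: \<D>_def)
      show "\<Inter>\<D> \<subseteq> {x}"
      proof
        fix y assume "y \<in> \<Inter>\<D>"
        then have y: "y \<in> mcball x r" if "r > 0" for r
          using that by (auto simp: \<D>_def)
        \<comment> \<open>The summand \<open>0\<close> matches the form of
          \<open>field_le_epsilon\<close>.\<close>
        have "d x y \<le> 0 + r" if "r > 0" for r
          using y[OF that] by simp
        then have "d x y \<le> 0"
          by (rule field_le_epsilon)
        then show "y \<in> {x}"
          using y[of 1] nonneg[of x y] by (auto simp: zero)
      qed
    qed
    ultimately have "isGlb UNIV (\<nu> ` \<D>) (\<nu> {x})"
      using qsm unfolding Q_smooth_def by metis
    moreover have "filtered (\<nu> ` \<D>)"
      unfolding filtered_def
    proof (intro conjI ballI)
      show "\<nu> ` \<D> \<noteq> {}" by (auto simp: \<D>_def)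
      fix a b assume "a \<in> \<nu> ` \<D>" "b \<in> \<nu> ` \<D>"
      then obtain Q R where QR: "Q \<in> \<D>" "R \<in> \<D>" "a = \<nu> Q" "b = \<nu> R" by auto
      then obtain T where T: "T \<in> \<D>" "T \<subseteq> Q" "T \<subseteq> R"
        using \<open>filtered \<D>\<close> QR(1,2) unfolding filtered_def by meson
      have "Q \<in> borel_sets X" "R \<in> borel_sets X" "T \<in> borel_sets X"
        using QR(1,2) T(1) borel by (auto simp: \<D>_def)
      then show "\<exists>t\<in>\<nu> ` \<D>. t \<le> a \<and> t \<le> b"
        using T QR(3,4) by (intro bexI[of _ "\<nu> T"]) (auto intro: measure_mono)
    qed
    ultimately show ?thesis
      using way_above_filtered[OF s[OF x], of "\<nu> ` \<D>" "\<nu> {x}"] by (auto simp: \<D>_def)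
  qed
  then obtain r where r: "\<And>x. x \<in> K \<Longrightarrow> r x > 0 \<and> \<nu> (mcball x (r x) \<inter> K) \<le> s"
    by metis
  have "openin X U" if "U \<in> (\<lambda>x. mball x (r x)) ` K" for U
    using that by (auto simp: X)
  moreover have "K \<subseteq> \<Union>((\<lambda>x. mball x (r x)) ` K)"
  proof
    fix x assume x: "x \<in> K"
    then have "x \<in> mball x (r x)"
      using r[OF x] compactin_subset_topspace[OF K] by (auto simp: X)
    with x show "x \<in> \<Union>((\<lambda>x. mball x (r x)) ` K)" by auto
  qed
  ultimately obtain \<F> where \<F>: "finite \<F>" "\<F> \<subseteq> (\<lambda>x. mball x (r x)) ` K" "K \<subseteq> \<Union>\<F>"
    using compactinD[OF K, of "(\<lambda>x. mball x (r x)) ` K"] by auto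
  then obtain F where F: "finite F" "F \<subseteq> K" "K \<subseteq> (\<Union>x\<in>F. mball x (r x))"
    using finite_subset_image[OF \<F>(1,2)] by metis
  \<comment> \<open>Open balls give the finite cover, but the bound holds for the compact traces of
    closed balls.\<close>
  define \<A> where "\<A> = (\<lambda>x. mcball x (r x) \<inter> K) ` F"
  have "\<Union>\<A> = K"
  proof
    show "\<Union>\<A> \<subseteq> K" by (auto simp: \<A>_def)
    show "K \<subseteq> \<Union>\<A>"
    proof
      fix y assume y: "y \<in> K"
      then obtain x where x: "x \<in> F" "y \<in> mball x (r x)"
        using F(3) by auto
      then have "y \<in> mcball x (r x) \<inter> K" using y by simp
      then show "y \<in> \<Union>\<A>" using x(1) by (auto simp: \<A>_def)
    qed
  qed
  moreover have "\<nu> (\<Union>\<A>) \<le> s"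
    using F(1,2) r borel by (intro measure_finite_Union_le) (auto simp: \<A>_def)
  ultimately show ?thesis by simp
qed

text \<open>
  Instead of local compactness, the smoothness of \<open>\<nu>\<close> along the compact tails \<open>{l, \<sigma> n, \<sigma> (n + 1), \<dots>}\<close> of a
  convergent sequence is used, whose intersection is \<open>{l}\<close>.
\<close>

lemma metrizable_usc_singleton_measure:
  assumes met: "metrizable_space X" and qsm: "Q_smooth X \<nu>"
  shows "usc X (\<lambda>x. \<nu> {x})"
  unfolding usc_def
proof
  fix t
  obtain M d where "Metric_space M d" and X: "X = Metric_space.mtopology M d"
    using met by (auto simp: metrizable_space_def)
  then interpret Metric_space M d by simp
  have t1: "t1_space X"
    using met by (simp add: metrizable_imp_t1_space)
  define V where "V = {x \<in> topspace X. t \<ggreater> \<nu> {x}}"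
  have "closedin mtopology (M - V)"
    unfolding metric_closedin_iff_sequentially_closed
  proof (intro conjI allI impI; (elim conjE)?)
    fix \<sigma> l
    assume \<sigma>: "range \<sigma> \<subseteq> M - V" and lim: "limitin mtopology \<sigma> l sequentially"
    have lM: "l \<in> M"
      using limitin_topspace[OF lim] by simp
    show "l \<in> M - V"
    proof (rule ccontr)
      assume "l \<notin> M - V"
      then have "t \<ggreater> \<nu> {l}"
        using lM by (simp add: V_def X)
      \<comment> \<open>\<open>t'\<close> leaves room: \<open>\<nu> (K n) \<le> t'\<close> will make
        \<open>t\<close> way above \<open>\<nu> {\<sigma> n}\<close>, although
        \<open>\<sigma> n\<close> lies outside \<open>V\<close>.\<close>
      then obtain t' where t': "t \<ggreater> t'" "t' \<ggreater> \<nu> {l}"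
        using way_above_interpolation[OF dom] by metis
      define K where "K n = insert l (\<sigma> ` {n..})" for n :: nat
      have cK: "K n \<in> compact_saturated X" for n
      proof -
        have "compactin mtopology (K n)"
          unfolding K_def using \<sigma> by (intro compactin_sequence_with_limit[OF lim]) auto
        then show ?thesis
          using t1_space_compact_saturated[OF t1, of "K n"] by (simp add: X)
      qed
      then have KB: "K n \<in> borel_sets X" for n
        by (rule compact_saturated_borel_sets)
      have anti: "K n \<subseteq> K m" if "m \<le> n" for m n
        using that by (auto simp: K_def)
      have "filtered (range K)"
        unfolding filtered_def
      proof (intro conjI ballI)
        fix a b assume "a \<in> range K" "b \<in> range K"
        then obtain m n where "a = K m" "b = K n" by auto
        then show "\<exists>t\<in>range K. t \<subseteq> a \<and> t \<subseteq> b"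
          using anti by (intro bexI[of _ "K (max m n)"]) auto
      qed simp
      moreover have "\<Inter>(range K) = {l}"
      proof
        show "\<Inter>(range K) \<subseteq> {l}"
        proof
          fix y assume y: "y \<in> \<Inter>(range K)"
          show "y \<in> {l}"
          proof (rule ccontr)
            assume "y \<notin> {l}"
            moreover have "y \<in> M"
              using y borel_sets_subset[OF KB[of 0]] by (auto simp: X)
            ultimately have "openin mtopology (M - {y})" "l \<in> M - {y}"
              using t1 lM by (auto simp: X intro!: closedin_t1_singleton)
            \<comment> \<open>The sequence eventually enters the open complement of
              \<open>y\<close>, so some tail omits \<open>y\<close>.\<close>
            then obtain N where "\<And>n. N \<le> n \<Longrightarrow> \<sigma> n \<in> M - {y}"
              using lim unfolding limitin_sequentially by metis
            then have "y \<notin> K N"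
              using \<open>y \<notin> {l}\<close> by (auto simp: K_def)
            then show False using y by auto
          qed
        qed
        show "{l} \<subseteq> \<Inter>(range K)"
          by (auto simp: K_def)
      qed
      moreover have "range K \<subseteq> compact_saturated X"
        using cK by auto
      ultimately have "isGlb UNIV (\<nu> ` range K) (\<nu> {l})"
        using qsm unfolding Q_smooth_def by metis
      moreover have "filtered (\<nu> ` range K)"
        unfolding filtered_def
      proof (intro conjI ballI)
        fix a b assume "a \<in> \<nu> ` range K" "b \<in> \<nu> ` range K"
        then obtain m n where mn: "a = \<nu> (K m)" "b = \<nu> (K n)" by auto
        show "\<exists>t\<in>\<nu> ` range K. t \<le> a \<and> t \<le> b"
          unfolding mn by (intro bexI[of _ "\<nu> (K (max m n))"] conjI measure_mono KB anti) auto
      qed simp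
      ultimately obtain n where n: "\<nu> (K n) \<le> t'"
        using way_above_filtered[OF t'(2), of "\<nu> ` range K" "\<nu> {l}"] by auto
      have "\<sigma> n \<in> M - V" using \<sigma> by auto
      then have "{\<sigma> n} \<in> borel_sets X"
        using t1 by (intro compact_saturated_borel_sets) (simp add: t1_space_compact_saturated finite_imp_compactin X)
      then have "\<nu> {\<sigma> n} \<le> \<nu> (K n)"
        by (rule measure_mono[OF _ KB]) (simp add: K_def)
      then have "\<nu> {\<sigma> n} \<le> t'" using n by (rule order_trans)
      then have "t \<ggreater> \<nu> {\<sigma> n}"
        by (rule way_above_ge_trans[OF t'(1)])
      then show False
        using \<open>\<sigma> n \<in> M - V\<close> by (simp add: V_def X)
    qed
  qed auto
  moreover have "V \<subseteq> topspace mtopology"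
    by (auto simp: V_def X)
  ultimately have "openin X V"
    unfolding X by (simp add: openin_closedin_eq)
  then show "openin X {x \<in> topspace X. t \<ggreater> \<nu> {x}}"
    by (simp add: V_def)
qed

text \<open>Weak outer-continuity is not yet available, so the measure of singletons itself serves
  as density. The open set \<open>G\<close> of points where \<open>s\<close> is way above it is a
  countable union of compact sets of measure at most \<open>s\<close>.\<close>

lemma sigma_compact_metrizable_imp_usc_density:
  assumes met: "metrizable_space X" and sc: "sigma_compact X" and qsm: "Q_smooth X \<nu>"
    and sm: "sigma_maxitive X \<nu>"
  shows "\<exists>c. usc X c \<and> cardinal_density X \<nu> c"
proof (intro exI conjI)
  have u: "usc X (\<lambda>x. \<nu> {x})"
    by (rule metrizable_usc_singleton_measure[OF met qsm])
  then show "usc X (\<lambda>x. \<nu> {x})" .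
  have t1: "t1_space X"
    using met by (simp add: metrizable_imp_t1_space)
  have sing: "{x} \<in> borel_sets X" if "x \<in> topspace X" for x
    using that t1 by (intro compact_saturated_borel_sets) (simp add: t1_space_compact_saturated finite_imp_compactin)
  show "cardinal_density X \<nu> (\<lambda>x. \<nu> {x})"
    unfolding cardinal_density_def
  proof
    fix B assume B: "B \<in> borel_sets X"
    show "isLub UNIV ((\<lambda>x. \<nu> {x}) ` B) (\<nu> B)"
    proof (rule isLub_if_le_way_above[OF dom])
      fix a assume "a \<in> (\<lambda>x. \<nu> {x}) ` B"
      then obtain x where x: "x \<in> B" "a = \<nu> {x}" by auto
      show "a \<le> \<nu> B"
        unfolding x(2) using x(1) borel_sets_subset[OF B] by (intro measure_mono sing B) auto
    next
      fix u s
      assume u: "\<And>a. a \<in> (\<lambda>x. \<nu> {x}) ` B \<Longrightarrow> a \<le> u" and s: "s \<ggreater> u"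
      define G where "G = {x \<in> topspace X. s \<ggreater> \<nu> {x}}"
      have G: "openin X G"
        using \<open>usc X (\<lambda>x. \<nu> {x})\<close> by (simp add: usc_def G_def)
      have "s \<ggreater> \<nu> {x}" if "x \<in> B" for x
        by (rule way_above_ge_trans[OF s]) (intro u imageI that)
      then have "B \<subseteq> G"
        using borel_sets_subset[OF B] by (auto simp: G_def)
      then have "\<nu> B \<le> \<nu> G"
        by (rule measure_mono[OF B openin_borel_sets[OF G]])
      \<comment> \<open>Open sets of a metrizable space are countable unions of closed sets; meeting
        these with the compact cover \<C> makes the pieces compact.\<close>
      obtain C :: "nat \<Rightarrow> 'e set" where C: "\<And>n. closedin X (C n)" "\<Union>(range C) = G"
        using open_imp_fsigma_in[OF met G] unfolding fsigma_in_ascending by metis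
      obtain \<C> where \<C>: "countable \<C>" "\<And>K. K \<in> \<C> \<Longrightarrow> compactin X K" "\<Union>\<C> = topspace X"
        using sc unfolding sigma_compact_def by metis
      define \<A> where "\<A> = (\<lambda>(n, K). C n \<inter> K) ` (UNIV \<times> \<C>)"
      have cA: "compactin X A" and AG: "A \<subseteq> G" if "A \<in> \<A>" for A
        using that C \<C>(2) by (auto simp: \<A>_def intro: closed_Int_compactin)
      have AB: "\<A> \<subseteq> borel_sets X"
        using cA t1 by (auto simp: t1_space_compact_saturated intro: compact_saturated_borel_sets)
      have "countable \<A>"
        using \<C>(1) by (auto simp: \<A>_def)
      moreover have UA: "\<Union>\<A> = G"
      proof -
        have "\<Union>\<A> = \<Union>(range C) \<inter> \<Union>\<C>"
          by (auto simp: \<A>_def)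
        then show ?thesis
          using C(2) \<C>(3) openin_subset[OF G] by auto
      qed
      ultimately have "isLub UNIV (\<nu> ` \<A>) (\<nu> G)"
        using sm AB openin_borel_sets[OF G] unfolding sigma_maxitive_def by metis
      moreover have "\<nu> A \<le> s" if "A \<in> \<A>" for A
        using AG[OF that] by (intro metrizable_compact_measure_le[OF met qsm cA[OF that]]) (auto simp: G_def)
      ultimately have "\<nu> G \<le> s"
        by (simp add: isLub_UNIV_iff)
      with \<open>\<nu> B \<le> \<nu> G\<close> show "\<nu> B \<le> s"
        by (rule order_trans)
    qed
  qed
qed

end

section \<open>Assembly of the equivalences and their special cases\<close>

theorem theorem3p23:
  fixes X :: "'e topology" and \<nu> :: "'e set \<Rightarrow> 'l::order_bot"
  assumes "poset_domain TYPE('l)" and "quasisober X" and "maxitive X \<nu>"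
  shows "((\<exists>c. cardinal_density X \<nu> c) \<longleftrightarrow> completely_maxitive X \<nu>) \<and>
    (let
       A1 = regular_maxitive X \<nu>;
       A2 = (\<exists>c. usc X c \<and> cardinal_density X \<nu> c);
       A3 = (outer_continuous X \<nu> \<and> completely_maxitive X \<nu>);
       A4 = (weakly_outer_continuous X \<nu> \<and> weakly_inner_continuous X \<nu>);
       A5 = (weakly_outer_continuous X \<nu> \<and> sigma_maxitive X \<nu>);
       A6 = weakly_outer_continuous X \<nu>;
       A7 = (Q_smooth X \<nu> \<and> saturated_measure X \<nu>);
       A8 = (Q_smooth X \<nu> \<and> weakly_inner_continuous X \<nu> \<and> saturated_measure X \<nu>);
       A9 = (Q_smooth X \<nu> \<and> sigma_maxitive X \<nu> \<and> saturated_measure X \<nu>)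
     in
       (A1 \<longleftrightarrow> A2) \<and> (A2 \<longleftrightarrow> A3) \<and> (A3 \<longleftrightarrow> A4) \<and>
       (A4 \<longrightarrow> A5) \<and> (A5 \<longrightarrow> A6) \<and> (A6 \<longrightarrow> A7) \<and> (A8 \<longrightarrow> A7) \<and>
       (second_countable X \<longrightarrow>
          (A1 \<longleftrightarrow> A2) \<and> (A2 \<longleftrightarrow> A3) \<and> (A3 \<longleftrightarrow> A4) \<and> (A4 \<longleftrightarrow> A5)) \<and>
       (locally_compact_nbhds X \<longrightarrow>
          (A8 \<longleftrightarrow> A1) \<and> (A1 \<longleftrightarrow> A2) \<and> (A2 \<longleftrightarrow> A3) \<and> (A3 \<longleftrightarrow> A4) \<and> (A6 \<longleftrightarrow> A7)) \<and>
       (sigma_compact X \<and> metrizable_space X \<longrightarrow>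
          (A9 \<longleftrightarrow> A1) \<and> (A1 \<longleftrightarrow> A2) \<and> (A2 \<longleftrightarrow> A3) \<and> (A3 \<longleftrightarrow> A4) \<and> (A4 \<longleftrightarrow> A5)) \<and>
       (locally_compact_nbhds X \<and> polish X \<longrightarrow>
          (A8 \<longleftrightarrow> A9) \<and> (A9 \<longleftrightarrow> A1) \<and> (A1 \<longleftrightarrow> A2) \<and> (A2 \<longleftrightarrow> A3) \<and> (A3 \<longleftrightarrow> A4) \<and>
          (A4 \<longleftrightarrow> A5) \<and> (A6 \<longleftrightarrow> A7)))"
proof -
  interpret domain_maxitive X \<nu>
    using assms(1,3) by unfold_locales
  let ?A1 = "regular_maxitive X \<nu>"
  let ?A2 = "\<exists>c. usc X c \<and> cardinal_density X \<nu> c"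
  let ?A3 = "outer_continuous X \<nu> \<and> completely_maxitive X \<nu>"
  let ?A4 = "weakly_outer_continuous X \<nu> \<and> weakly_inner_continuous X \<nu>"
  let ?A5 = "weakly_outer_continuous X \<nu> \<and> sigma_maxitive X \<nu>"
  let ?A6 = "weakly_outer_continuous X \<nu>"
  let ?A7 = "Q_smooth X \<nu> \<and> saturated_measure X \<nu>"
  let ?A8 = "Q_smooth X \<nu> \<and> weakly_inner_continuous X \<nu> \<and> saturated_measure X \<nu>"
  let ?A9 = "Q_smooth X \<nu> \<and> sigma_maxitive X \<nu> \<and> saturated_measure X \<nu>"
  have density: "(\<exists>c. cardinal_density X \<nu> c) \<longleftrightarrow> completely_maxitive X \<nu>"
    using cardinal_density_imp_completely_maxitive completely_maxitive_imp_cardinal_density by metis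
  have i12: "?A1 \<Longrightarrow> ?A2"
    by (rule regular_imp_usc_density)
  have i23: "?A2 \<Longrightarrow> ?A3"
    using usc_density_imp_outer_continuous cardinal_density_imp_completely_maxitive by metis
  have i31: "?A3 \<Longrightarrow> ?A1"
    by (elim conjE) (rule outer_continuous_completely_maxitive_imp_regular)
  have i34: "?A3 \<Longrightarrow> ?A4"
    by (simp add: outer_continuous_imp_weakly outer_continuous_completely_maxitive_imp_weakly_inner)
  have i42: "?A4 \<Longrightarrow> ?A2"
    by (elim conjE) (rule weakly_continuous_imp_usc_density)
  \<comment> \<open>The two cycles run through \<open>?A1\<close>, \<open>?A2\<close>,
    \<open>?A3\<close> and through \<open>?A2\<close>, \<open>?A3\<close>,
    \<open>?A4\<close>.\<close>
  have e: "?A2 \<longleftrightarrow> ?A1" "?A3 \<longleftrightarrow> ?A1" "?A4 \<longleftrightarrow> ?A1"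
    using i12 i23 i31 i34 i42 by argo+
  have i45: "?A1 \<Longrightarrow> ?A5"
    using e(2) outer_continuous_imp_weakly completely_maxitive_imp_sigma_maxitive by metis
  have i67: "?A6 \<Longrightarrow> ?A7"
    using weakly_outer_continuous_imp_Q_smooth[OF assms(2)] weakly_outer_continuous_imp_saturated by simp
  have i18: "?A1 \<Longrightarrow> ?A8" and i19: "?A5 \<Longrightarrow> ?A9"
    using e(3) i67 by argo+
  have sc: "?A5 \<Longrightarrow> ?A1" if "second_countable X"
    using second_countable_imp_usc_density[OF that] e(1) by argo
  have lc76: "?A7 \<Longrightarrow> ?A6" if "locally_compact_nbhds X"
    using locally_compact_imp_weakly_outer[OF that] by simp
  \<comment> \<open>\<open>?A8\<close> contains \<open>?A7\<close>, which gives \<open>?A6\<close>;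
    with weak inner-continuity this is \<open>?A4\<close>.\<close>
  have lc81: "?A8 \<Longrightarrow> ?A1" if "locally_compact_nbhds X"
    using lc76[OF that] e(3) by argo
  have met: "?A9 \<Longrightarrow> ?A1" if "sigma_compact X" "metrizable_space X"
    using sigma_compact_metrizable_imp_usc_density[OF that(2,1)] e(1) by argo
  have pol: "second_countable X" if "polish X"
    using that separable_metrizable_imp_second_countable completely_metrizable_imp_metrizable_space
    unfolding polish_def by metis
  \<comment> \<open>Local compactness gives \<open>?A6\<close>, which with \<sigma>-maxitivity is
    \<open>?A5\<close>; second countability then gives \<open>?A1\<close>.\<close>
  have lcp: "?A9 \<Longrightarrow> ?A1" if "locally_compact_nbhds X" "polish X"
    using lc76[OF that(1)] sc[OF pol[OF that(2)]] by argo
  show ?thesis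
    \<comment> \<open>Rewriting with \<open>e\<close> collapses \<open>?A2\<close>,
      \<open>?A3\<close> and \<open>?A4\<close> to \<open>?A1\<close>; what remains is
      propositional.\<close>
    unfolding Let_def e
    using density i45 i67 i18 i19 sc lc76 lc81 met pol lcp by argo
qed

end
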